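(* Let $K$ be a simple (or $1$-dimensional) Lie group of compact type, with Lie algebra $\mathfrak{k}$ and complexification $K_{\mathbb{C}}$, $\mathrm{Lie}(K_{\mathbb{C}})=\mathfrak{k}_{\mathbb{C}}=\mathfrak{k}\oplus J\mathfrak{k}$. Then $\mathfrak{k}$ has a unique (up to scale) $\mathrm{Ad}$-invariant real inner product $\langle\cdot,\cdot\rangle_{\mathfrak{k}}$, and all $\mathrm{Ad}(K)$-invariant real inner products on $\mathfrak{k}_{\mathbb{C}}$ have the form $$\langle X_1+JY_1,X_2+JY_2\rangle_{a,b,c}=a\langle X_1,X_2\rangle_{\mathfrak{k}}+b\langle Y_1,Y_2\rangle_{\mathfrak{k}}+c\big(\langle X_1,Y_2\rangle_{\mathfrak{k}}+\langle X_2,Y_1\rangle_{\mathfrak{k}}\big),\qquad X_1,X_2,Y_1,Y_2\in\mathfrak{k},$$ for some $a,b,c\in\mathbb{R}$ with $a,b>0$ and $c^2<ab$.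
   Context: A connected Lie group $K$ with Lie algebra $\mathfrak{k}$ is of compact type if $\mathfrak{k}$ admits an $\mathrm{Ad}(K)$-invariant real inner product. A Lie group $K$ is simple if $\dim K\ge 2$ and $\mathfrak{k}$ has no nontrivial ideals. The complexification $K_{\mathbb{C}}$ of a compact-type group $K$ is the complex Lie group, containing $K$, through which every smooth homomorphism from $K$ to a complex Lie group extends uniquely to a holomorphic homomorphism; its Lie algebra is $\mathfrak{k}_{\mathbb{C}}=\mathfrak{k}\oplus J\mathfrak{k}$, where $J$ denotes multiplication by $i$. An inner product (real bilinear, symmetric, positive definite) on $\mathfrak{k}_{\mathbb{C}}$, viewed as a real vector space, is $\mathrm{Ad}(K)$-invariant if it is preserved by $\mathrm{Ad}_x\colon\mathfrak{k}_{\mathbb{C}}\to\mathfrak{k}_{\mathbb{C}}$ for all $x\in K$, where $\mathrm{Ad}_x(X+JY)=\mathrm{Ad}_xX+J\,\mathrm{Ad}_xY$. *)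

theory Defs
  imports
    "HOL-Analysis.Analysis"
    "HOL-Algebra.Group"
    "HOL-Library.FuncSet"
    "HOL-Library.Function_Algebras"
begin

section \<open>Smooth functions on open subsets of \<open>R^n\<close>\<close>

text \<open>
  Here \<open>R^n\<close> is the space \<^const>\<open>Euclidean_space\<close> \<open>n\<close> of all \<open>x :: nat \<Rightarrow> real\<close> with
  \<open>x i = 0\<close> for \<open>i \<ge> n\<close>. The dimension is thus a number and not a type, so that one statement
  can speak about manifolds of all dimensions (see \<open>is_complexification\<close> below).
\<close>

definition partial :: "nat \<Rightarrow> ((nat \<Rightarrow> real) \<Rightarrow> real) \<Rightarrow> (nat \<Rightarrow> real) \<Rightarrow> real" where
  "partial i f x = deriv (\<lambda>t. f (x(i := t))) (x i)"

primrec Ck_on :: "nat \<Rightarrow> (nat \<Rightarrow> real) set \<Rightarrow> nat \<Rightarrow> ((nat \<Rightarrow> real) \<Rightarrow> real) \<Rightarrow> bool" where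
  "Ck_on n W 0 f \<longleftrightarrow> continuous_map (subtopology (Euclidean_space n) W) euclideanreal f"
| "Ck_on n W (Suc k) f \<longleftrightarrow>
     continuous_map (subtopology (Euclidean_space n) W) euclideanreal f \<and>
     (\<forall>i<n. (\<forall>x\<in>W. (\<lambda>t. f (x(i := t))) field_differentiable at (x i)) \<and>
            Ck_on n W k (partial i f))"

definition smooth_on :: "nat \<Rightarrow> (nat \<Rightarrow> real) set \<Rightarrow> ((nat \<Rightarrow> real) \<Rightarrow> real) \<Rightarrow> bool" where
  "smooth_on n W f \<longleftrightarrow> (\<forall>k. Ck_on n W k f)"


section \<open>Smooth manifolds\<close>

text \<open>A chart \<open>(U, \<phi>)\<close> is given by its domain and its coordinate map; only the values of
  \<open>\<phi>\<close> on \<open>U\<close> matter.\<close>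

type_synonym 'a chart = "'a set \<times> ('a \<Rightarrow> nat \<Rightarrow> real)"

record 'a manifold =
  mtop :: "'a topology"
  mdim :: nat
  atlas :: "'a chart set"

definition charts_at :: "'a manifold \<Rightarrow> 'a \<Rightarrow> 'a chart set" where
  "charts_at M p = {c \<in> atlas M. p \<in> fst c}"

text \<open>The local expression \<open>\<psi> \<circ> F \<circ> \<phi>\<inverse>\<close> of a map \<open>F\<close> in charts \<open>c = (U, \<phi>)\<close> and
  \<open>d = (V, \<psi>)\<close>, and the set \<open>\<phi> (U \<inter> F\<inverse> V)\<close> on which it is considered.\<close>

definition local_expr :: "'a chart \<Rightarrow> 'b chart \<Rightarrow> ('a \<Rightarrow> 'b) \<Rightarrow> (nat \<Rightarrow> real) \<Rightarrow> nat \<Rightarrow> real" where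
  "local_expr c d F x = snd d (F (inv_into (fst c) (snd c) x))"

definition local_dom :: "'a chart \<Rightarrow> 'b chart \<Rightarrow> ('a \<Rightarrow> 'b) \<Rightarrow> (nat \<Rightarrow> real) set" where
  "local_dom c d F = snd c ` {p \<in> fst c. F p \<in> fst d}"

definition smooth_map :: "'a manifold \<Rightarrow> 'b manifold \<Rightarrow> ('a \<Rightarrow> 'b) \<Rightarrow> bool" where
  "smooth_map M N F \<longleftrightarrow>
     continuous_map (mtop M) (mtop N) F \<and>
     (\<forall>c\<in>atlas M. \<forall>d\<in>atlas N. \<forall>j<mdim N.
        smooth_on (mdim M) (local_dom c d F) (\<lambda>x. local_expr c d F x j))"

definition is_chart :: "'a manifold \<Rightarrow> 'a chart \<Rightarrow> bool" where
  "is_chart M c \<longleftrightarrow>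
     openin (mtop M) (fst c) \<and>
     openin (Euclidean_space (mdim M)) (snd c ` fst c) \<and>
     homeomorphic_map (subtopology (mtop M) (fst c))
       (subtopology (Euclidean_space (mdim M)) (snd c ` fst c)) (snd c)"

text \<open>The atlas need not be maximal. The last conjunct says that all changes of charts are smooth:
  the local expressions of the identity are the transition maps.\<close>

definition smooth_manifold :: "'a manifold \<Rightarrow> bool" where
  "smooth_manifold M \<longleftrightarrow>
     Hausdorff_space (mtop M) \<and> second_countable (mtop M) \<and>
     (\<forall>c\<in>atlas M. is_chart M c) \<and>
     (\<Union>c\<in>atlas M. fst c) = topspace (mtop M) \<and>
     smooth_map M M (\<lambda>p. p)"

definition prod_chart :: "nat \<Rightarrow> 'a chart \<Rightarrow> 'b chart \<Rightarrow> ('a \<times> 'b) chart" where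
  "prod_chart n c d =
     (fst c \<times> fst d, \<lambda>(p, q) i. if i < n then snd c p i else snd d q (i - n))"

definition prod_manifold :: "'a manifold \<Rightarrow> 'b manifold \<Rightarrow> ('a \<times> 'b) manifold" where
  "prod_manifold M N =
     \<lparr>mtop = prod_topology (mtop M) (mtop N), mdim = mdim M + mdim N,
      atlas = {prod_chart (mdim M) c d | c d. c \<in> atlas M \<and> d \<in> atlas N}\<rparr>"


section \<open>Tangent vectors\<close>

text \<open>
  A tangent vector at \<open>p\<close> assigns to every chart around \<open>p\<close> a coordinate vector, in such a way
  that a change of charts transforms the coordinates by its Jacobian matrix. Outside the charts
  around \<open>p\<close> and beyond the dimension it is padded with \<open>0\<close>, so that addition and
  scaling are pointwise.
\<close>

type_synonym 'a tangent = "'a chart \<Rightarrow> nat \<Rightarrow> real"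

definition tscale :: "real \<Rightarrow> 'a tangent \<Rightarrow> 'a tangent" (infixr \<open>*\<^sub>t\<close> 75) where
  "r *\<^sub>t v = (\<lambda>c i. r * v c i)"

interpretation tangent: vector_space "tscale :: real \<Rightarrow> 'a tangent \<Rightarrow> 'a tangent"
  by unfold_locales (simp_all add: tscale_def fun_eq_iff algebra_simps)

definition tangent_space :: "'a manifold \<Rightarrow> 'a \<Rightarrow> 'a tangent set" where
  "tangent_space M p =
     {v. (\<forall>c. c \<notin> charts_at M p \<longrightarrow> v c = 0) \<and>
         (\<forall>c\<in>charts_at M p. \<forall>i\<ge>mdim M. v c i = 0) \<and>
         (\<forall>c\<in>charts_at M p. \<forall>d\<in>charts_at M p. \<forall>j<mdim M.
            v d j = (\<Sum>i<mdim M. partial i (\<lambda>x. local_expr c d (\<lambda>q. q) x j) (snd c p) * v c i))}"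

text \<open>The derivative \<open>v f\<close> at \<open>p\<close> of a real function \<open>f\<close> that is smooth near \<open>p\<close>; by the chain
  rule it does not depend on the chart chosen.\<close>

definition dir_deriv :: "'a manifold \<Rightarrow> 'a \<Rightarrow> 'a tangent \<Rightarrow> ('a \<Rightarrow> real) \<Rightarrow> real" where
  "dir_deriv M p v f =
     (let c = (SOME c. c \<in> charts_at M p)
      in \<Sum>i<mdim M. partial i (\<lambda>x. f (inv_into (fst c) (snd c) x)) (snd c p) * v c i)"

definition differential ::
    "'a manifold \<Rightarrow> 'b manifold \<Rightarrow> 'a \<Rightarrow> ('a \<Rightarrow> 'b) \<Rightarrow> 'a tangent \<Rightarrow> 'b tangent" where
  "differential M N p F v =
     (\<lambda>d j. if d \<in> charts_at N (F p) \<and> j < mdim N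
            then dir_deriv M p v (\<lambda>q. snd d (F q) j) else 0)"


section \<open>Lie groups and Lie algebras\<close>

record 'a lie_struct = "'a monoid" +
  mfld :: "'a manifold"

definition lie_group :: "'a lie_struct \<Rightarrow> bool" where
  "lie_group G \<longleftrightarrow>
     group G \<and> smooth_manifold (mfld G) \<and> topspace (mtop (mfld G)) = carrier G \<and>
     smooth_map (prod_manifold (mfld G) (mfld G)) (mfld G) (\<lambda>(x, y). x \<otimes>\<^bsub>G\<^esub> y) \<and>
     smooth_map (mfld G) (mfld G) (\<lambda>x. inv\<^bsub>G\<^esub> x)"

definition lie_algebra :: "'a lie_struct \<Rightarrow> 'a tangent set" where
  "lie_algebra G = tangent_space (mfld G) \<one>\<^bsub>G\<^esub>"

text \<open>
  The Lie bracket is the commutator of left-invariant vector fields. The left-invariant field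
  extending \<open>Y\<close> maps a function \<open>f\<close> to \<open>x \<mapsto> Y (y \<mapsto> f (x y))\<close>, so at the identity the commutator
  of the fields extending \<open>X\<close> and \<open>Y\<close> maps \<open>f\<close> to the difference below; the coordinates of a
  tangent vector are its values on the coordinate functions.
\<close>

definition lie_bracket :: "'a lie_struct \<Rightarrow> 'a tangent \<Rightarrow> 'a tangent \<Rightarrow> 'a tangent" where
  "lie_bracket G X Y =
     (let D = dir_deriv (mfld G) \<one>\<^bsub>G\<^esub>
      in (\<lambda>d j. if d \<in> charts_at (mfld G) \<one>\<^bsub>G\<^esub> \<and> j < mdim (mfld G)
               then D X (\<lambda>x. D Y (\<lambda>y. snd d (x \<otimes>\<^bsub>G\<^esub> y) j)) - D Y (\<lambda>x. D X (\<lambda>y. snd d (x \<otimes>\<^bsub>G\<^esub> y) j))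
               else 0))"

definition lie_ideal :: "'a lie_struct \<Rightarrow> 'a tangent set \<Rightarrow> bool" where
  "lie_ideal G I \<longleftrightarrow>
     I \<subseteq> lie_algebra G \<and> tangent.subspace I \<and>
     (\<forall>X\<in>lie_algebra G. \<forall>Y\<in>I. lie_bracket G X Y \<in> I)"

definition simple_lie_group :: "'a lie_struct \<Rightarrow> bool" where
  "simple_lie_group G \<longleftrightarrow>
     lie_group G \<and> mdim (mfld G) \<ge> 2 \<and> (\<forall>I. lie_ideal G I \<longrightarrow> I = {0} \<or> I = lie_algebra G)"

definition Ad :: "'a lie_struct \<Rightarrow> 'a \<Rightarrow> 'a tangent \<Rightarrow> 'a tangent" where
  "Ad G x = differential (mfld G) (mfld G) \<one>\<^bsub>G\<^esub> (\<lambda>y. x \<otimes>\<^bsub>G\<^esub> y \<otimes>\<^bsub>G\<^esub> inv\<^bsub>G\<^esub> x)"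


section \<open>Invariant inner products\<close>

definition inner_product_on :: "'a tangent set \<Rightarrow> ('a tangent \<Rightarrow> 'a tangent \<Rightarrow> real) \<Rightarrow> bool" where
  "inner_product_on V B \<longleftrightarrow>
     (\<forall>u\<in>V. \<forall>v\<in>V. \<forall>w\<in>V. B (u + v) w = B u w + B v w) \<and>
     (\<forall>r. \<forall>u\<in>V. \<forall>w\<in>V. B (r *\<^sub>t u) w = r * B u w) \<and>
     (\<forall>u\<in>V. \<forall>v\<in>V. B u v = B v u) \<and>
     (\<forall>u\<in>V. u \<noteq> 0 \<longrightarrow> B u u > 0)"

definition Ad_invariant_inner ::
    "'a lie_struct \<Rightarrow> ('a tangent \<Rightarrow> 'a tangent \<Rightarrow> real) \<Rightarrow> bool" where
  "Ad_invariant_inner K B \<longleftrightarrow>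
     inner_product_on (lie_algebra K) B \<and>
     (\<forall>x\<in>carrier K. \<forall>X\<in>lie_algebra K. \<forall>Y\<in>lie_algebra K. B (Ad K x X) (Ad K x Y) = B X Y)"

definition compact_type :: "'a lie_struct \<Rightarrow> bool" where
  "compact_type K \<longleftrightarrow>
     lie_group K \<and> connected_space (mtop (mfld K)) \<and> (\<exists>B. Ad_invariant_inner K B)"


section \<open>Complex Lie groups and complexification\<close>

text \<open>
  A complex manifold of complex dimension \<open>m\<close> is a manifold of real dimension \<open>2 m\<close>, where \<open>C^m\<close> is
  identified with \<open>R^(2 m)\<close> by \<open>z\<^sub>k = x\<^bsub>2k\<^esub> + i x\<^bsub>2k+1\<^esub>\<close>. With this order of the coordinates
  the product of two complex manifolds is \<^const>\<open>prod_manifold\<close>.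
\<close>

definition cauchy_riemann ::
    "nat \<Rightarrow> nat \<Rightarrow> ((nat \<Rightarrow> real) \<Rightarrow> nat \<Rightarrow> real) \<Rightarrow> (nat \<Rightarrow> real) \<Rightarrow> bool" where
  "cauchy_riemann n m f x \<longleftrightarrow>
     (\<forall>k < n div 2. \<forall>l < m div 2.
        partial (2*k) (\<lambda>x. f x (2*l)) x = partial (2*k+1) (\<lambda>x. f x (2*l+1)) x \<and>
        partial (2*k+1) (\<lambda>x. f x (2*l)) x = - partial (2*k) (\<lambda>x. f x (2*l+1)) x)"

definition holomorphic_map :: "'a manifold \<Rightarrow> 'b manifold \<Rightarrow> ('a \<Rightarrow> 'b) \<Rightarrow> bool" where
  "holomorphic_map M N F \<longleftrightarrow>
     smooth_map M N F \<and>
     (\<forall>c\<in>atlas M. \<forall>d\<in>atlas N. \<forall>x\<in>local_dom c d F.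
        cauchy_riemann (mdim M) (mdim N) (local_expr c d F) x)"

text \<open>As for smooth manifolds, the last conjunct says that the transition maps are holomorphic.\<close>

definition complex_manifold :: "'a manifold \<Rightarrow> bool" where
  "complex_manifold M \<longleftrightarrow> smooth_manifold M \<and> even (mdim M) \<and> holomorphic_map M M (\<lambda>p. p)"

definition complex_lie_group :: "'a lie_struct \<Rightarrow> bool" where
  "complex_lie_group G \<longleftrightarrow>
     lie_group G \<and> complex_manifold (mfld G) \<and>
     holomorphic_map (prod_manifold (mfld G) (mfld G)) (mfld G) (\<lambda>(x, y). x \<otimes>\<^bsub>G\<^esub> y) \<and>
     holomorphic_map (mfld G) (mfld G) (\<lambda>x. inv\<^bsub>G\<^esub> x)"

text \<open>Multiplication by \<open>i\<close> on tangent vectors of a complex manifold.\<close>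

definition Jmul :: "'a tangent \<Rightarrow> 'a tangent" where
  "Jmul v = (\<lambda>c i. if even i then - v c (i + 1) else v c (i - 1))"

text \<open>
  \<open>\<iota>\<close> is the inclusion of \<open>K\<close> into its complexification \<open>KC\<close>. The universal property ranges over
  all complex Lie groups whose underlying set consists of real numbers. This is no restriction:
  manifolds are second countable, hence have at most continuum many points, so every complex Lie
  group is isomorphic to one of these.
\<close>

definition is_complexification :: "'a lie_struct \<Rightarrow> 'b lie_struct \<Rightarrow> ('a \<Rightarrow> 'b) \<Rightarrow> bool" where
  "is_complexification K KC \<iota> \<longleftrightarrow>
     complex_lie_group KC \<and>
     \<iota> \<in> hom K KC \<and> inj_on \<iota> (carrier K) \<and> smooth_map (mfld K) (mfld KC) \<iota> \<and>
     (\<forall>(G :: real lie_struct) h.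
        complex_lie_group G \<and> h \<in> hom K G \<and> smooth_map (mfld K) (mfld G) h \<longrightarrow>
        (\<exists>!H. H \<in> extensional (carrier KC) \<and> H \<in> hom KC G \<and>
              holomorphic_map (mfld KC) (mfld G) H \<and> (\<forall>x\<in>carrier K. H (\<iota> x) = h x)))"

text \<open>The element \<open>X + J Y\<close> of the Lie algebra of \<open>KC\<close>, for \<open>X\<close> and \<open>Y\<close> in the Lie algebra of \<open>K\<close>,
  which is regarded as a subset of the Lie algebra of \<open>KC\<close> by the differential of the inclusion.\<close>

definition plusJ :: "'a lie_struct \<Rightarrow> 'b lie_struct \<Rightarrow> ('a \<Rightarrow> 'b) \<Rightarrow> 'a tangent \<Rightarrow> 'a tangent \<Rightarrow> 'b tangent"
  where
  "plusJ K KC \<iota> X Y =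
     (let d\<iota> = differential (mfld K) (mfld KC) \<one>\<^bsub>K\<^esub> \<iota> in d\<iota> X + Jmul (d\<iota> Y))"

text \<open>\<open>Lie(KC) = k \<oplus> J k\<close>.\<close>

definition lie_algebra_splits :: "'a lie_struct \<Rightarrow> 'b lie_struct \<Rightarrow> ('a \<Rightarrow> 'b) \<Rightarrow> bool" where
  "lie_algebra_splits K KC \<iota> \<longleftrightarrow>
     bij_betw (\<lambda>(X, Y). plusJ K KC \<iota> X Y) (lie_algebra K \<times> lie_algebra K) (lie_algebra KC)"

text \<open>\<open>Ad\<^sub>x (X + J Y) = Ad\<^sub>x X + J Ad\<^sub>x Y\<close> for \<open>x \<in> K\<close>.\<close>

definition AdC :: "'a lie_struct \<Rightarrow> 'b lie_struct \<Rightarrow> ('a \<Rightarrow> 'b) \<Rightarrow> 'a \<Rightarrow> 'b tangent \<Rightarrow> 'b tangent" where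
  "AdC K KC \<iota> x Z =
     (case inv_into (lie_algebra K \<times> lie_algebra K) (\<lambda>(X, Y). plusJ K KC \<iota> X Y) Z of
        (X, Y) \<Rightarrow> plusJ K KC \<iota> (Ad K x X) (Ad K x Y))"

definition AdK_invariant_inner ::
    "'a lie_struct \<Rightarrow> 'b lie_struct \<Rightarrow> ('a \<Rightarrow> 'b) \<Rightarrow> ('b tangent \<Rightarrow> 'b tangent \<Rightarrow> real) \<Rightarrow> bool" where
  "AdK_invariant_inner K KC \<iota> B \<longleftrightarrow>
     inner_product_on (lie_algebra KC) B \<and>
     (\<forall>x\<in>carrier K. \<forall>Z\<in>lie_algebra KC. \<forall>W\<in>lie_algebra KC.
        B (AdC K KC \<iota> x Z) (AdC K KC \<iota> x W) = B Z W)"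

end

theory Submission
  imports Defs
begin

text \<open>
  Everything reduces to one statement: \<^emph>\<open>every \<open>Ad\<close>-invariant bilinear form \<open>c\<close> on \<open>k\<close>, symmetric or
  not, is a real multiple of a given invariant inner product \<open>ip\<close>\<close> (\<open>invariant_form_proportional\<close>).
  Applied to a second inner product it gives uniqueness. An invariant inner product \<open>B\<close> on
  \<open>k + J k\<close> restricts to three invariant forms on \<open>k\<close>, namely \<open>B (X, Y)\<close>, \<open>B (J X, J Y)\<close> and
  \<open>B (X, J Y)\<close>; the factors of proportionality are \<open>a\<close>, \<open>b\<close> and \<open>c\<close>, and \<open>c\<^sup>2 < a b\<close> is positivity
  of the Gram matrix of \<open>X\<close> and \<open>J X\<close>.
  
  The only ideals of \<open>k\<close> are \<open>0\<close> and \<open>k\<close>, and the radical of an invariant form is an ideal, so that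
  an invariant form with a nonzero vector in its radical vanishes. For symmetric \<open>c\<close> let \<open>r\<close> be the
  minimum of \<open>c (X, X) / ip (X, X)\<close>. Then \<open>c - r ip\<close> is positive semidefinite, a minimiser lies in its
  radical, and hence \<open>c = r ip\<close>. For skew-symmetric \<open>c\<close> the trilinear form \<open>c ([X, Y], Z)\<close> is
  antisymmetric in \<open>X, Y\<close> and symmetric in \<open>Y, Z\<close>, so it is zero. If the radical of \<open>c\<close> is zero, then
  \<open>k\<close> is therefore abelian, every line in \<open>k\<close> is an ideal, \<open>k\<close> has dimension at most one, and again
  \<open>c = 0\<close>. The radical argument is also valid in dimension one, where all subspaces are trivial.
  
  The radical is an ideal because of the infinitesimal invariance \<open>c ([X, Y], Z) = - c (Y, [X, Z])\<close>,
  which rests on the formula \<open>[X, Y] = d/dt Ad (exp t X) Y\<close>. The latter is proved here along the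
  coordinate lines \<open>x (t)\<close> through the identity instead of one-parameter groups
  (\<open>bracket_basis_is_Ad_derivative\<close>). Conjugation followed by right translation is left
  translation, so \<open>dR\<^sub>x (Ad\<^sub>x Y) = dL\<^sub>x Y\<close>. Differentiating this at the identity expresses the
  derivative of \<open>Ad\<^sub>x Y\<close> by mixed second partial derivatives of the multiplication in coordinates; the
  symmetry of these derivatives turns the result into the commutator of left-invariant fields.
  
  The calculus behind it uses curves only: differentials of maps are identified by their effect on
  velocities of curves, so that the single analytic tool is the chain rule for a \<open>C\<^sup>1\<close>
  function along a differentiable curve.
\<close>

section \<open>Calculus on coordinate boxes\<close>

text \<open>
  The type \<^typ>\<open>nat \<Rightarrow> real\<close> carries no norm, and \<open>R^n\<close> is not open in it. A neighbourhood in \<open>R^n\<close> is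
  therefore given by an explicit box, together with the condition that its centre lies in \<open>R^n\<close>.
\<close>

definition coord_nhd :: "nat \<Rightarrow> (nat \<Rightarrow> real) \<Rightarrow> (nat \<Rightarrow> real) set \<Rightarrow> bool" where
  "coord_nhd n x W \<longleftrightarrow> (\<forall>i\<ge>n. x i = 0) \<and>
     (\<exists>e>0. \<forall>y. (\<forall>i<n. \<bar>y i - x i\<bar> < e) \<and> (\<forall>i\<ge>n. y i = 0) \<longrightarrow> y \<in> W)"

lemma coord_nhd_imp_mem: "coord_nhd n x W \<Longrightarrow> x \<in> W"
  unfolding coord_nhd_def by auto

lemma openin_Euclidean_space_imp_coord_nhd:
  assumes W: "openin (Euclidean_space n) W" and x: "x \<in> W"
  shows "coord_nhd n x W"
proof -
  have x0: "\<forall>i\<ge>n. x i = 0"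
    using openin_subset[OF W] x by (auto simp: topspace_Euclidean_space)
  obtain T where T: "openin (powertop_real UNIV) T" and WT: "W = T \<inter> {x. \<forall>i\<ge>n. x i = 0}"
    using W unfolding Euclidean_space_def openin_subtopology by blast
  have "x \<in> T" using x WT by blast
  with T[unfolded openin_product_topology_alt] obtain U
    where "finite {i \<in> UNIV. U i \<noteq> topspace euclideanreal}" "\<forall>i\<in>UNIV. openin euclideanreal (U i)"
      and xU: "x \<in> PiE UNIV U" and UT: "PiE UNIV U \<subseteq> T"
    by blast
  then have op: "\<And>i. open (U i)" by simp
  have "\<exists>d>0. \<forall>t. \<bar>t - x i\<bar> < d \<longrightarrow> t \<in> U i" for i
    using op[of i] xU unfolding open_dist by (auto simp: PiE_iff dist_real_def)
  then obtain d where d: "\<And>i. d i > 0" "\<And>i t. \<bar>t - x i\<bar> < d i \<Longrightarrow> t \<in> U i"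
    by metis
  define e where "e = Min (insert 1 (d ` {..<n}))"
  have "e > 0" unfolding e_def using d(1) by (subst Min_gr_iff) auto
  have ed: "e \<le> d i" if "i < n" for i
    unfolding e_def using that by (intro Min_le) auto
  show ?thesis
    unfolding coord_nhd_def
  proof (intro conjI x0 exI[of _ e] \<open>e > 0\<close> allI impI)
    fix y assume y: "(\<forall>i<n. \<bar>y i - x i\<bar> < e) \<and> (\<forall>i\<ge>n. y i = 0)"
    have "y i \<in> U i" for i
    proof (cases "i < n")
      case True
      then show ?thesis using y ed[of i] d(2)[of "y i" i] by fastforce
    next
      case False
      then show ?thesis using y x0 xU by (metis PiE_mem UNIV_I not_less)
    qed
    then show "y \<in> W" using UT WT y by auto
  qed
qed

lemma eventually_in_coord_nhd:
  assumes W: "coord_nhd n x W"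
    and lim: "\<And>i. i < n \<Longrightarrow> ((\<lambda>t. \<eta> t i) \<longlongrightarrow> x i) F"
    and pad: "eventually (\<lambda>t. \<forall>i\<ge>n. \<eta> t i = 0) F"
  shows "eventually (\<lambda>t. \<eta> t \<in> W) F"
proof -
  obtain e where "e > 0" and e: "\<And>y. (\<forall>i<n. \<bar>y i - x i\<bar> < e) \<Longrightarrow> (\<forall>i\<ge>n. y i = 0) \<Longrightarrow> y \<in> W"
    using W unfolding coord_nhd_def by auto
  have "eventually (\<lambda>t. \<forall>i\<in>{..<n}. \<bar>\<eta> t i - x i\<bar> < e) F"
    using lim \<open>e > 0\<close> by (intro eventually_ball_finite) (auto simp: tendsto_iff dist_real_def)
  then show ?thesis
    using pad by eventually_elim (use e in auto)
qed

lemma coord_nhd_continuous: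
  assumes f: "continuous_map (subtopology (Euclidean_space n) W) euclideanreal f"
    and W: "coord_nhd n x W" and "e > 0"
  shows "coord_nhd n x {y \<in> W. \<bar>f y - f x\<bar> < e}"
proof -
  have x: "x \<in> W" "\<forall>i\<ge>n. x i = 0"
    using W coord_nhd_imp_mem by (auto simp: coord_nhd_def)
  define S where "S = {y \<in> topspace (subtopology (Euclidean_space n) W). f y \<in> ball (f x) e}"
  have "openin (subtopology (Euclidean_space n) W) S"
    unfolding S_def using f by (rule openin_continuous_map_preimage) auto
  then obtain T where T: "openin (Euclidean_space n) T" "S = T \<inter> W"
    unfolding openin_subtopology by blast
  have "x \<in> S" using x \<open>e > 0\<close> by (simp add: S_def topspace_Euclidean_space)
  then have "coord_nhd n x T"
    using T openin_Euclidean_space_imp_coord_nhd by blast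
  then obtain d1 where "d1 > 0"
    and d1: "\<And>y. (\<forall>i<n. \<bar>y i - x i\<bar> < d1) \<and> (\<forall>i\<ge>n. y i = 0) \<Longrightarrow> y \<in> T"
    unfolding coord_nhd_def by blast
  obtain d2 where "d2 > 0"
    and d2: "\<And>y. (\<forall>i<n. \<bar>y i - x i\<bar> < d2) \<and> (\<forall>i\<ge>n. y i = 0) \<Longrightarrow> y \<in> W"
    using W unfolding coord_nhd_def by blast
  have TW: "y \<in> S" if "y \<in> T" "y \<in> W" for y
    using T that by auto
  show ?thesis
    unfolding coord_nhd_def
  proof (intro conjI x(2) exI[of _ "min d1 d2"] allI impI)
    show "0 < min d1 d2" using \<open>d1 > 0\<close> \<open>d2 > 0\<close> by simp
    fix y assume "(\<forall>i<n. \<bar>y i - x i\<bar> < min d1 d2) \<and> (\<forall>i\<ge>n. y i = 0)"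
    then have "y \<in> W" "y \<in> T" using d1 d2 by auto
    then show "y \<in> {y \<in> W. \<bar>f y - f x\<bar> < e}"
      using TW[of y] by (auto simp: S_def dist_real_def abs_minus_commute)
  qed
qed

lemma tendsto_continuous_coord:
  assumes f: "continuous_map (subtopology (Euclidean_space n) W) euclideanreal f"
    and W: "coord_nhd n x W"
    and lim: "\<And>i. i < n \<Longrightarrow> ((\<lambda>t. \<eta> t i) \<longlongrightarrow> x i) F"
    and pad: "eventually (\<lambda>t. \<forall>i\<ge>n. \<eta> t i = 0) F"
  shows "((\<lambda>t. f (\<eta> t)) \<longlongrightarrow> f x) F"
proof (rule tendstoI)
  fix e :: real assume "e > 0"
  from eventually_in_coord_nhd[OF coord_nhd_continuous[OF f W this] lim pad]
  show "eventually (\<lambda>t. dist (f (\<eta> t)) (f x) < e) F"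
    by (auto simp: dist_real_def elim: eventually_mono)
qed

lemma Ck_on_has_partial:
  assumes "Ck_on n W (Suc k) f" "x \<in> W" "i < n"
  shows "((\<lambda>t. f (x(i := t))) has_real_derivative partial i f x) (at (x i))"
  using assms by (auto simp: partial_def DERIV_deriv_iff_field_differentiable)

lemma mean_value_between:
  fixes f :: "real \<Rightarrow> real"
  assumes d: "\<And>s. \<bar>s - a\<bar> \<le> \<bar>b - a\<bar> \<Longrightarrow> (f has_real_derivative f' s) (at s)"
  shows "\<exists>\<xi>. \<bar>\<xi> - a\<bar> \<le> \<bar>b - a\<bar> \<and> f b - f a = f' \<xi> * (b - a)"
proof (cases a b rule: linorder_cases)
  case less
  then obtain z where "a < z" "z < b" "f b - f a = (b - a) * f' z"
    using MVT2[of a b f f'] d by force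
  then show ?thesis by (intro exI[of _ z]) auto
next
  case greater
  then obtain z where "b < z" "z < a" "f a - f b = (a - b) * f' z"
    using MVT2[of b a f f'] d by force
  then show ?thesis by (intro exI[of _ z]) (auto simp: algebra_simps)
qed auto

text \<open>
  The increment of \<open>f\<close> along a curve is split into steps that each move one coordinate. For a
  single step the mean value theorem supplies an intermediate point, and continuity of the partial
  derivative takes it to the limit.
\<close>

lemma chain_rule_curve_step:
  assumes f: "Ck_on n W (Suc 0) f" and W: "coord_nhd n x W" and k: "k < n"
    and \<gamma>: "\<And>i. i < n \<Longrightarrow> ((\<lambda>t. \<gamma> t i) has_real_derivative v i) (at t0)"
    and x: "\<gamma> t0 = x"
  shows "((\<lambda>t. f (\<lambda>i. if i < Suc k then \<gamma> t i else x i) - f (\<lambda>i. if i < k then \<gamma> t i else x i))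
           has_real_derivative partial k f x * v k) (at t0)"
proof -
  define z where "z = (\<lambda>t i. if i < k then \<gamma> t i else x i)"
  have xpad: "\<forall>i\<ge>n. x i = 0" using W by (simp add: coord_nhd_def)
  have \<gamma>lim: "((\<lambda>t. \<gamma> t i) \<longlongrightarrow> x i) (at t0)" if "i < n" for i
    using \<gamma>[OF that] x DERIV_isCont isContD by metis
  define P where "P = (\<lambda>t \<xi>. \<bar>\<xi> - x k\<bar> \<le> \<bar>\<gamma> t k - x k\<bar> \<and>
    f ((z t)(k := \<gamma> t k)) - f (z t) = partial k f ((z t)(k := \<xi>)) * (\<gamma> t k - x k))"
  obtain e where "e > 0"
    and e: "\<And>y. (\<forall>i<n. \<bar>y i - x i\<bar> < e) \<Longrightarrow> (\<forall>i\<ge>n. y i = 0) \<Longrightarrow> y \<in> W"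
    using W unfolding coord_nhd_def by auto
  have "eventually (\<lambda>t. \<forall>i\<in>{..<n}. \<bar>\<gamma> t i - x i\<bar> < e) (at t0)"
    using \<gamma>lim \<open>e > 0\<close> by (intro eventually_ball_finite) (auto simp: tendsto_iff dist_real_def)
  then have evP: "eventually (\<lambda>t. \<exists>\<xi>. P t \<xi>) (at t0)"
  proof eventually_elim
    case (elim t)
    have "((\<lambda>s. f ((z t)(k := s))) has_real_derivative partial k f ((z t)(k := s))) (at s)"
      if "\<bar>s - x k\<bar> \<le> \<bar>\<gamma> t k - x k\<bar>" for s
    proof -
      have "(z t)(k := s) \<in> W"
      proof (intro e allI impI)
        fix i assume "i < n"
        show "\<bar>((z t)(k := s)) i - x i\<bar> < e"
          using elim that k \<open>i < n\<close> \<open>e > 0\<close> by (cases "i = k") (force simp: z_def)+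
      next
        fix i assume "n \<le> i"
        then show "((z t)(k := s)) i = 0" using k xpad by (auto simp: z_def)
      qed
      from Ck_on_has_partial[OF f this k] show ?thesis by simp
    qed
    from mean_value_between[of "x k" "\<gamma> t k", OF this]
    obtain \<xi> where "\<bar>\<xi> - x k\<bar> \<le> \<bar>\<gamma> t k - x k\<bar>"
      "f ((z t)(k := \<gamma> t k)) - f ((z t)(k := x k)) = partial k f ((z t)(k := \<xi>)) * (\<gamma> t k - x k)"
      by blast
    moreover have "(z t)(k := x k) = z t" by (auto simp: z_def)
    ultimately show ?case by (auto simp: P_def)
  qed
  define \<xi> where "\<xi> t = (SOME \<xi>. P t \<xi>)" for t
  have ev\<xi>: "eventually (\<lambda>t. P t (\<xi> t)) (at t0)"
    using evP by eventually_elim (unfold \<xi>_def, rule someI_ex)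
  have "((\<lambda>t. \<bar>\<gamma> t k - x k\<bar>) \<longlongrightarrow> 0) (at t0)"
    using tendsto_rabs[OF tendsto_diff[OF \<gamma>lim[OF k] tendsto_const[of "x k"]]] by simp
  then have "((\<lambda>t. \<xi> t - x k) \<longlongrightarrow> 0) (at t0)"
    by (rule Lim_null_comparison[rotated]) (use ev\<xi> in \<open>eventually_elim, simp add: P_def\<close>)
  then have \<xi>lim: "(\<xi> \<longlongrightarrow> x k) (at t0)"
    using LIM_zero_iff by blast
  have "((\<lambda>t. partial k f ((z t)(k := \<xi> t))) \<longlongrightarrow> partial k f x) (at t0)"
  proof (rule tendsto_continuous_coord[OF _ W])
    show "continuous_map (subtopology (Euclidean_space n) W) euclideanreal (partial k f)"
      using f k by simp
    show "((\<lambda>t. ((z t)(k := \<xi> t)) i) \<longlongrightarrow> x i) (at t0)" if "i < n" for i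
      using \<xi>lim \<gamma>lim[OF that] by (cases "i = k"; cases "i < k") (auto simp: z_def)
  qed (use k xpad in \<open>auto simp: z_def\<close>)
  moreover have "((\<lambda>t. (\<gamma> t k - x k) / (t - t0)) \<longlongrightarrow> v k) (at t0)"
    using \<gamma>[OF k] x unfolding has_field_derivative_iff by auto
  ultimately have "((\<lambda>t. partial k f ((z t)(k := \<xi> t)) * ((\<gamma> t k - x k) / (t - t0)))
      \<longlongrightarrow> partial k f x * v k) (at t0)"
    by (rule tendsto_mult)
  moreover have "eventually (\<lambda>t. partial k f ((z t)(k := \<xi> t)) * ((\<gamma> t k - x k) / (t - t0)) =
      (f ((z t)(k := \<gamma> t k)) - f (z t)) / (t - t0)) (at t0)"
    using ev\<xi> by eventually_elim (simp add: P_def)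
  ultimately have *: "((\<lambda>t. (f ((z t)(k := \<gamma> t k)) - f (z t)) / (t - t0))
      \<longlongrightarrow> partial k f x * v k) (at t0)"
    by (rule Lim_transform_eventually)
  have 1: "(z t)(k := \<gamma> t k) = (\<lambda>i. if i < Suc k then \<gamma> t i else x i)" for t
    by (auto simp: z_def less_Suc_eq)
  have 2: "(\<lambda>i. if i < j then \<gamma> t0 i else x i) = x" for j
    using x by auto
  show ?thesis
    using * unfolding has_field_derivative_iff 1 by (simp add: 2 z_def)
qed

lemma chain_rule_curve:
  assumes f: "Ck_on n W (Suc 0) f" and W: "coord_nhd n (\<gamma> t0) W"
    and \<gamma>: "\<And>i. i < n \<Longrightarrow> ((\<lambda>t. \<gamma> t i) has_real_derivative v i) (at t0)"
    and pad: "eventually (\<lambda>t. \<forall>i\<ge>n. \<gamma> t i = 0) (nhds t0)"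
  shows "((\<lambda>t. f (\<gamma> t)) has_real_derivative (\<Sum>i<n. partial i f (\<gamma> t0) * v i)) (at t0)"
proof -
  have "((\<lambda>t. f (\<lambda>i. if i < k then \<gamma> t i else \<gamma> t0 i)) has_real_derivative
      (\<Sum>i<k. partial i f (\<gamma> t0) * v i)) (at t0)" if "k \<le> n" for k
    using that
  proof (induction k)
    case (Suc k)
    from DERIV_add[OF chain_rule_curve_step[OF f W _ \<gamma> refl, of k] Suc.IH] Suc.prems
    show ?case by (simp add: add.commute)
  qed auto
  from this[of n] have *: "((\<lambda>t. f (\<lambda>i. if i < n then \<gamma> t i else \<gamma> t0 i)) has_real_derivative
      (\<Sum>i<n. partial i f (\<gamma> t0) * v i)) (at t0)" by simp
  have W0: "\<forall>i\<ge>n. \<gamma> t0 i = 0" using W by (simp add: coord_nhd_def)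
  have "eventually (\<lambda>t. f (\<gamma> t) = f (\<lambda>i. if i < n then \<gamma> t i else \<gamma> t0 i)) (nhds t0)"
    using pad
  proof eventually_elim
    case (elim t)
    then have "\<gamma> t = (\<lambda>i. if i < n then \<gamma> t i else \<gamma> t0 i)" using W0 by auto
    then show ?case by simp
  qed
  then show ?thesis
    using * DERIV_cong_ev[OF refl _ refl] by fast
qed

text \<open>
  The second difference over a square of side \<open>h\<close> is symmetric in the two directions, while its
  limit, found by the mean value theorem first in direction \<open>i\<close> and then in direction \<open>j\<close>, is
  a mixed derivative in one fixed order. Comparing both orders gives Clairaut's theorem below.
\<close>

lemma second_difference_limit:
  assumes f: "Ck_on n W (Suc (Suc 0)) f" and W: "coord_nhd n x W"
    and ij: "i < n" "j < n" "i \<noteq> j"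
  shows "((\<lambda>h. (f (x(i := x i + h, j := x j + h)) - f (x(i := x i + h))
           - f (x(j := x j + h)) + f x) / h\<^sup>2) \<longlongrightarrow> partial j (partial i f) x) (at_right 0)"
proof (rule tendstoI)
  fix r :: real assume "r > 0"
  have fi: "Ck_on n W (Suc 0) (partial i f)" using f ij by simp
  then have "continuous_map (subtopology (Euclidean_space n) W) euclideanreal (partial j (partial i f))"
    using ij by simp
  from coord_nhd_continuous[OF this W \<open>r > 0\<close>]
  obtain e where "e > 0" and xpad: "\<forall>i\<ge>n. x i = 0"
    and e: "\<And>y. (\<forall>i<n. \<bar>y i - x i\<bar> < e) \<and> (\<forall>i\<ge>n. y i = 0) \<Longrightarrow>
      y \<in> W \<and> \<bar>partial j (partial i f) y - partial j (partial i f) x\<bar> < r"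
    unfolding coord_nhd_def by auto
  have "eventually (\<lambda>h. h \<in> {0<..<e}) (at_right 0)"
    using \<open>e > 0\<close> by (rule eventually_at_right_real)
  then show "eventually (\<lambda>h. dist ((f (x(i := x i + h, j := x j + h)) - f (x(i := x i + h))
           - f (x(j := x j + h)) + f x) / h\<^sup>2) (partial j (partial i f) x) < r) (at_right 0)"
  proof eventually_elim
    case (elim h)
    then have h: "0 < h" "h < e" by auto
    have y: "x(i := s, j := t) \<in> W \<and>
        \<bar>partial j (partial i f) (x(i := s, j := t)) - partial j (partial i f) x\<bar> < r"
      if "\<bar>s - x i\<bar> \<le> h" "\<bar>t - x j\<bar> \<le> h" for s t
      using that h ij xpad \<open>e > 0\<close> by (intro e) auto
    have der: "((\<lambda>s. f (x(i := s, j := t))) has_real_derivative partial i f (x(i := s, j := t))) (at s)"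
      if "\<bar>s - x i\<bar> \<le> h" "\<bar>t - x j\<bar> \<le> h" for s t
      using Ck_on_has_partial[OF f _ ij(1), of "x(i := s, j := t)"] y[OF that] ij
      by (simp add: fun_upd_twist)
    have "((\<lambda>s. f (x(i := s, j := x j + h)) - f (x(i := s, j := x j))) has_real_derivative
        (partial i f (x(i := s, j := x j + h)) - partial i f (x(i := s, j := x j)))) (at s)"
      if "\<bar>s - x i\<bar> \<le> \<bar>x i + h - x i\<bar>" for s
      using that h by (intro DERIV_diff der) auto
    from mean_value_between[of "x i" "x i + h", OF this] obtain s where s: "\<bar>s - x i\<bar> \<le> h"
      and 1: "(f (x(i := x i + h, j := x j + h)) - f (x(i := x i + h, j := x j))) -
          (f (x(i := x i, j := x j + h)) - f (x(i := x i, j := x j))) =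
        (partial i f (x(i := s, j := x j + h)) - partial i f (x(i := s, j := x j))) * h"
      using h by auto
    have "((\<lambda>t. partial i f (x(i := s, j := t))) has_real_derivative
        partial j (partial i f) (x(i := s, j := t))) (at t)"
      if "\<bar>t - x j\<bar> \<le> \<bar>x j + h - x j\<bar>" for t
      using Ck_on_has_partial[OF fi _ ij(2), of "x(i := s, j := t)"] y[OF s, of t] that h by simp
    from mean_value_between[of "x j" "x j + h", OF this] obtain t where t: "\<bar>t - x j\<bar> \<le> h"
      and 2: "partial i f (x(i := s, j := x j + h)) - partial i f (x(i := s, j := x j)) =
        partial j (partial i f) (x(i := s, j := t)) * h"
      using h by auto
    have "x(i := x i + h, j := x j) = x(i := x i + h)" using ij(3) by auto
    with 1 2 h have "(f (x(i := x i + h, j := x j + h)) - f (x(i := x i + h))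
           - f (x(j := x j + h)) + f x) / h\<^sup>2 = partial j (partial i f) (x(i := s, j := t))"
      by (simp add: power2_eq_square divide_simps)
    with y[OF s t] show ?case by (simp add: dist_real_def)
  qed
qed

lemma partial_commute:
  assumes f: "Ck_on n W (Suc (Suc 0)) f" and W: "coord_nhd n x W" and ij: "i < n" "j < n"
  shows "partial i (partial j f) x = partial j (partial i f) x"
proof (cases "i = j")
  case False
  have "((\<lambda>h. (f (x(j := x j + h, i := x i + h)) - f (x(j := x j + h))
           - f (x(i := x i + h)) + f x) / h\<^sup>2) \<longlongrightarrow> partial j (partial i f) x) (at_right 0)"
    using second_difference_limit[OF f W ij False] False
    by (simp add: fun_upd_twist algebra_simps)
  from tendsto_unique[OF _ second_difference_limit[OF f W ij(2,1)] this] False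
  show ?thesis by simp
qed simp


section \<open>Velocities of curves\<close>

text \<open>
  The part of being a chart that calculus along curves needs. Unlike \<^const>\<open>is_chart\<close> it passes to
  product charts without any discussion of products of Euclidean spaces.
\<close>

definition chart_opens_to_boxes :: "'a manifold \<Rightarrow> 'a chart \<Rightarrow> bool" where
  "chart_opens_to_boxes M c \<longleftrightarrow> openin (mtop M) (fst c) \<and> inj_on (snd c) (fst c) \<and>
     (\<forall>V p. openin (mtop M) V \<and> V \<subseteq> fst c \<and> p \<in> V \<longrightarrow> coord_nhd (mdim M) (snd c p) (snd c ` V))"

lemma is_chart_imp_opens_to_boxes:
  assumes "is_chart M c"
  shows "chart_opens_to_boxes M c"
proof -
  have U: "openin (mtop M) (fst c)" and E: "openin (Euclidean_space (mdim M)) (snd c ` fst c)"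
    and h: "homeomorphic_map (subtopology (mtop M) (fst c))
       (subtopology (Euclidean_space (mdim M)) (snd c ` fst c)) (snd c)"
    using assms by (auto simp: is_chart_def)
  have ts: "topspace (subtopology (mtop M) (fst c)) = fst c"
    using openin_subset[OF U] by (auto simp: topspace_subtopology)
  have inj: "inj_on (snd c) (fst c)"
    using h ts by (metis homeomorphic_imp_injective_map)
  have "coord_nhd (mdim M) (snd c p) (snd c ` V)"
    if V: "openin (mtop M) V" "V \<subseteq> fst c" "p \<in> V" for V p
  proof (rule openin_Euclidean_space_imp_coord_nhd)
    have "openin (subtopology (mtop M) (fst c)) V"
      using V by (simp add: openin_subset_topspace_eq openin_open_subtopology[OF U])
    then have "openin (subtopology (Euclidean_space (mdim M)) (snd c ` fst c)) (snd c ` V)"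
      using homeomorphic_imp_open_map[OF h] by (auto simp: open_map_def)
    then show "openin (Euclidean_space (mdim M)) (snd c ` V)"
      using openin_open_subtopology[OF E] by simp
  qed (use V in auto)
  with U inj show ?thesis by (auto simp: chart_opens_to_boxes_def)
qed

lemma tangent_space_change:
  assumes "v \<in> tangent_space M p" "c \<in> charts_at M p" "d \<in> charts_at M p" "j < mdim M"
  shows "v d j = (\<Sum>i<mdim M. partial i (\<lambda>x. local_expr c d (\<lambda>q. q) x j) (snd c p) * v c i)"
  using assms unfolding tangent_space_def by blast

lemma tangent_space_pad:
  assumes "v \<in> tangent_space M p" "\<not> (c \<in> charts_at M p \<and> i < mdim M)"
  shows "v c i = 0"
proof (cases "c \<in> charts_at M p")
  case True
  then show ?thesis using assms unfolding tangent_space_def by auto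
next
  case False
  then have "v c = 0" using assms(1) unfolding tangent_space_def by blast
  then show ?thesis by simp
qed

lemma tangent_spaceI:
  assumes "\<And>c i. \<not> (c \<in> charts_at M p \<and> i < mdim M) \<Longrightarrow> v c i = 0"
    and "\<And>c d j. c \<in> charts_at M p \<Longrightarrow> d \<in> charts_at M p \<Longrightarrow> j < mdim M \<Longrightarrow>
      v d j = (\<Sum>i<mdim M. partial i (\<lambda>x. local_expr c d (\<lambda>q. q) x j) (snd c p) * v c i)"
  shows "v \<in> tangent_space M p"
  unfolding tangent_space_def
proof (intro CollectI conjI allI ballI impI assms(2))
  show "v c = 0" if "c \<notin> charts_at M p" for c
    using assms(1) that by (intro ext) simp
qed (use assms(1) in auto)

lemma smooth_manifold_chart:
  assumes "smooth_manifold M" "c \<in> charts_at M p"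
  shows "c \<in> atlas M" "p \<in> fst c" "p \<in> topspace (mtop M)"
    "openin (mtop M) (fst c)" "chart_opens_to_boxes M c"
proof -
  show c: "c \<in> atlas M" and p: "p \<in> fst c" using assms by (auto simp: charts_at_def)
  then have "is_chart M c" using assms(1) by (auto simp: smooth_manifold_def)
  then show "openin (mtop M) (fst c)" "chart_opens_to_boxes M c"
    by (auto simp: is_chart_def is_chart_imp_opens_to_boxes)
  then show "p \<in> topspace (mtop M)" using p openin_subset by blast
qed

lemma charts_at_nonempty:
  "smooth_manifold M \<Longrightarrow> p \<in> topspace (mtop M) \<Longrightarrow> \<exists>c. c \<in> charts_at M p"
  unfolding smooth_manifold_def charts_at_def by blast

lemma limitin_eventually_nhds:
  assumes "limitin X \<gamma> (\<gamma> t0) (at t0)" "openin X V" "\<gamma> t0 \<in> V"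
  shows "eventually (\<lambda>t. \<gamma> t \<in> V) (nhds t0)"
  using assms by (auto simp: limitin_def eventually_nhds_conv_at)

text \<open>
  The chain rule for a smooth map in charts. For the identity map it is the rule for changing
  charts, and for multiplication on a product it is the product rule for curves in a Lie group.
\<close>

lemma smooth_map_along_curve:
  assumes F: "smooth_map M N F"
    and c: "c \<in> atlas M" "chart_opens_to_boxes M c" "\<gamma> t0 \<in> fst c"
    and d: "d \<in> atlas N" "openin (mtop N) (fst d)" "F (\<gamma> t0) \<in> fst d"
    and lim: "limitin (mtop M) \<gamma> (\<gamma> t0) (at t0)"
    and w: "\<And>i. i < mdim M \<Longrightarrow> ((\<lambda>t. snd c (\<gamma> t) i) has_real_derivative w i) (at t0)"
    and j: "j < mdim N"
  shows "((\<lambda>t. snd d (F (\<gamma> t)) j) has_real_derivative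
     (\<Sum>i<mdim M. partial i (\<lambda>x. local_expr c d F x j) (snd c (\<gamma> t0)) * w i)) (at t0)"
proof -
  let ?n = "mdim M" and ?f = "\<lambda>x. local_expr c d F x j"
  have U: "openin (mtop M) (fst c)" and inj: "inj_on (snd c) (fst c)"
    and box: "\<And>V p. openin (mtop M) V \<Longrightarrow> V \<subseteq> fst c \<Longrightarrow> p \<in> V \<Longrightarrow>
      coord_nhd ?n (snd c p) (snd c ` V)"
    using c(2) by (auto simp: chart_opens_to_boxes_def)
  have "openin (mtop M) {p \<in> topspace (mtop M). F p \<in> fst d}"
    using F d(2) by (auto simp: smooth_map_def intro: openin_continuous_map_preimage)
  then have "openin (mtop M) (fst c \<inter> {p \<in> topspace (mtop M). F p \<in> fst d})"
    using U by blast
  moreover have "fst c \<inter> {p \<in> topspace (mtop M). F p \<in> fst d} = {p \<in> fst c. F p \<in> fst d}"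
    using openin_subset[OF U] by auto
  ultimately have W: "coord_nhd ?n (snd c (\<gamma> t0)) (local_dom c d F)"
    using c(3) d(3) by (auto simp: local_dom_def intro!: box)
  have ev: "eventually (\<lambda>t. \<gamma> t \<in> fst c) (nhds t0)"
    using limitin_eventually_nhds[OF lim U c(3)] .
  have "eventually (\<lambda>t. \<forall>i\<ge>?n. snd c (\<gamma> t) i = 0) (nhds t0)"
    using ev by eventually_elim (use box[OF U] in \<open>auto simp: coord_nhd_def\<close>)
  moreover have "Ck_on ?n (local_dom c d F) (Suc 0) ?f"
    using F c(1) d(1) j by (auto simp: smooth_map_def smooth_on_def simp del: Ck_on.simps)
  ultimately have "((\<lambda>t. ?f (snd c (\<gamma> t))) has_real_derivative
      (\<Sum>i<?n. partial i ?f (snd c (\<gamma> t0)) * w i)) (at t0)"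
    using chain_rule_curve[of ?n "local_dom c d F" ?f "\<lambda>t. snd c (\<gamma> t)" t0 w] W w by auto
  moreover have "eventually (\<lambda>t. ?f (snd c (\<gamma> t)) = snd d (F (\<gamma> t)) j) (nhds t0)"
    using ev by eventually_elim (simp add: local_expr_def inv_into_f_f[OF inj])
  ultimately show ?thesis
    using DERIV_cong_ev[OF refl _ refl] by fast
qed

text \<open>
  Convergence in the manifold is part of the definition because a coordinate map has arbitrary values
  outside its domain, so that differentiable coordinates would not keep the curve inside the chart.
  The padding is that of tangent vectors and makes the velocity unique.
\<close>

definition has_velocity :: "'a manifold \<Rightarrow> (real \<Rightarrow> 'a) \<Rightarrow> real \<Rightarrow> 'a tangent \<Rightarrow> bool" where
  "has_velocity M \<gamma> t0 v \<longleftrightarrow> limitin (mtop M) \<gamma> (\<gamma> t0) (at t0) \<and>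
     (\<forall>c i. if c \<in> charts_at M (\<gamma> t0) \<and> i < mdim M
            then ((\<lambda>t. snd c (\<gamma> t) i) has_real_derivative v c i) (at t0) else v c i = 0)"

lemma has_velocity_deriv:
  "has_velocity M \<gamma> t0 v \<Longrightarrow> c \<in> charts_at M (\<gamma> t0) \<Longrightarrow> i < mdim M \<Longrightarrow>
    ((\<lambda>t. snd c (\<gamma> t) i) has_real_derivative v c i) (at t0)"
  unfolding has_velocity_def by presburger

lemma has_velocity_pad:
  "has_velocity M \<gamma> t0 v \<Longrightarrow> \<not> (c \<in> charts_at M (\<gamma> t0) \<and> i < mdim M) \<Longrightarrow> v c i = 0"
  unfolding has_velocity_def by presburger

lemma has_velocity_limitin: "has_velocity M \<gamma> t0 v \<Longrightarrow> limitin (mtop M) \<gamma> (\<gamma> t0) (at t0)"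
  by (simp add: has_velocity_def)

lemma has_velocity_unique:
  assumes v: "has_velocity M \<gamma> t0 v" and w: "has_velocity M \<gamma> t0 w"
  shows "v = w"
proof (intro ext)
  fix c i show "v c i = w c i"
    using DERIV_unique has_velocity_deriv[OF v, of c i] has_velocity_deriv[OF w, of c i]
      has_velocity_pad[OF v, of c i] has_velocity_pad[OF w, of c i]
    by (cases "c \<in> charts_at M (\<gamma> t0) \<and> i < mdim M") auto
qed

lemma change_of_charts:
  assumes M: "smooth_manifold M"
    and lim: "limitin (mtop M) \<gamma> (\<gamma> t0) (at t0)"
    and c: "c \<in> charts_at M (\<gamma> t0)" and d: "d \<in> charts_at M (\<gamma> t0)"
    and w: "\<And>i. i < mdim M \<Longrightarrow> ((\<lambda>t. snd c (\<gamma> t) i) has_real_derivative w i) (at t0)"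
    and j: "j < mdim M"
  shows "((\<lambda>t. snd d (\<gamma> t) j) has_real_derivative
     (\<Sum>i<mdim M. partial i (\<lambda>x. local_expr c d (\<lambda>q. q) x j) (snd c (\<gamma> t0)) * w i)) (at t0)"
  using smooth_map_along_curve[of M M "\<lambda>q. q" c \<gamma> t0 d w j] M lim w j
    smooth_manifold_chart[OF M c] smooth_manifold_chart[OF M d]
  by (auto simp: smooth_manifold_def)

lemma velocity_in_tangent_space:
  assumes M: "smooth_manifold M" and v: "has_velocity M \<gamma> t0 v"
  shows "v \<in> tangent_space M (\<gamma> t0)"
proof (rule tangent_spaceI)
  fix c d j assume "c \<in> charts_at M (\<gamma> t0)" "d \<in> charts_at M (\<gamma> t0)" "j < mdim M"
  then show "v d j = (\<Sum>i<mdim M. partial i (\<lambda>x. local_expr c d (\<lambda>q. q) x j) (snd c (\<gamma> t0)) * v c i)"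
    using change_of_charts[OF M has_velocity_limitin[OF v], of c d "v c" j]
      has_velocity_deriv[OF v] DERIV_unique by blast
qed (use has_velocity_pad[OF v] in auto)

text \<open>
  Differentiability in one chart suffices, because coordinates in any other chart are then
  differentiable by the chain rule for the transition map.
\<close>

lemma has_velocity_from_chart:
  assumes M: "smooth_manifold M"
    and lim: "limitin (mtop M) \<gamma> (\<gamma> t0) (at t0)"
    and c: "c \<in> charts_at M (\<gamma> t0)"
    and w: "\<And>i. i < mdim M \<Longrightarrow> ((\<lambda>t. snd c (\<gamma> t) i) has_real_derivative w i) (at t0)"
  shows "has_velocity M \<gamma> t0 (\<lambda>d j. if d \<in> charts_at M (\<gamma> t0) \<and> j < mdim M
     then deriv (\<lambda>t. snd d (\<gamma> t) j) t0 else 0)"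
  unfolding has_velocity_def
proof (intro conjI lim allI)
  fix d j
  show "if d \<in> charts_at M (\<gamma> t0) \<and> j < mdim M
    then ((\<lambda>t. snd d (\<gamma> t) j) has_real_derivative (if d \<in> charts_at M (\<gamma> t0) \<and> j < mdim M
            then deriv (\<lambda>t. snd d (\<gamma> t) j) t0 else 0)) (at t0)
    else (if d \<in> charts_at M (\<gamma> t0) \<and> j < mdim M then deriv (\<lambda>t. snd d (\<gamma> t) j) t0 else 0) = 0"
    using change_of_charts[OF M lim c, of d w j] w
    by (auto simp: DERIV_deriv_iff_real_differentiable real_differentiable_def)
qed

text \<open>
  Coordinate lines through \<open>p\<close>, parametrised by the moving coordinate: the line passes through \<open>p\<close> at
  parameter \<open>snd c p i\<close> and not at \<open>0\<close>. This matches the definition of \<^const>\<open>partial\<close>, so that partial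
  derivatives of a function in the chart are literally derivatives along these curves.
\<close>

definition coord_curve :: "'a chart \<Rightarrow> 'a \<Rightarrow> nat \<Rightarrow> real \<Rightarrow> 'a" where
  "coord_curve c p i t = inv_into (fst c) (snd c) ((snd c p)(i := t))"

definition coord_vector :: "'a manifold \<Rightarrow> 'a chart \<Rightarrow> 'a \<Rightarrow> nat \<Rightarrow> 'a tangent" where
  "coord_vector M c p i = (\<lambda>d j. if d \<in> charts_at M p \<and> j < mdim M
     then deriv (\<lambda>t. snd d (coord_curve c p i t) j) (snd c p i) else 0)"

lemma coord_curve_base: "chart_opens_to_boxes M c \<Longrightarrow> p \<in> fst c \<Longrightarrow> coord_curve c p i (snd c p i) = p"
  by (simp add: coord_curve_def chart_opens_to_boxes_def)

lemma coord_curve_in_chart: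
  assumes c: "chart_opens_to_boxes M c" and V: "openin (mtop M) V" "V \<subseteq> fst c" "p \<in> V"
    and i: "i < mdim M"
  shows "eventually (\<lambda>t. coord_curve c p i t \<in> V \<and> snd c (coord_curve c p i t) = (snd c p)(i := t))
    (nhds (snd c p i))"
proof -
  have box: "coord_nhd (mdim M) (snd c p) (snd c ` V)" and inj: "inj_on (snd c) (fst c)"
    using c V by (auto simp: chart_opens_to_boxes_def)
  have "eventually (\<lambda>t. (snd c p)(i := t) \<in> snd c ` V) (nhds (snd c p i))"
  proof (rule eventually_in_coord_nhd[OF box])
    show "((\<lambda>t. ((snd c p)(i := t)) k) \<longlongrightarrow> snd c p k) (nhds (snd c p i))" for k
      by (cases "k = i") (auto intro: filterlim_ident)
    show "\<forall>\<^sub>F t in nhds (snd c p i). \<forall>k\<ge>mdim M. ((snd c p)(i := t)) k = 0"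
      using box i by (auto simp: coord_nhd_def)
  qed
  then show ?thesis
  proof eventually_elim
    case (elim t)
    then obtain q where "q \<in> V" "(snd c p)(i := t) = snd c q" by auto
    with V inj show ?case by (auto simp: coord_curve_def inv_into_f_f subset_iff)
  qed
qed

lemma coord_curve_limitin:
  assumes c: "chart_opens_to_boxes M c" and p: "p \<in> fst c" and i: "i < mdim M"
  shows "limitin (mtop M) (coord_curve c p i) p (at (snd c p i))"
  unfolding limitin_def
proof (intro conjI allI impI)
  have U: "openin (mtop M) (fst c)" using c by (simp add: chart_opens_to_boxes_def)
  then show "p \<in> topspace (mtop M)" using p openin_subset by blast
  fix V assume "openin (mtop M) V \<and> p \<in> V"
  then have "eventually (\<lambda>t. coord_curve c p i t \<in> V \<inter> fst c) (nhds (snd c p i))"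
    using coord_curve_in_chart[OF c, of "V \<inter> fst c" p i] U p i openin_Int[of "mtop M" V "fst c"]
    by (auto elim: eventually_mono)
  then have "eventually (\<lambda>t. coord_curve c p i t \<in> V) (nhds (snd c p i))"
    by (rule eventually_mono) simp
  then show "eventually (\<lambda>t. coord_curve c p i t \<in> V) (at (snd c p i))"
    by (simp add: eventually_nhds_conv_at)
qed

lemma coord_curve_chart_deriv:
  assumes c: "chart_opens_to_boxes M c" and p: "p \<in> fst c" and i: "i < mdim M"
  shows "((\<lambda>t. snd c (coord_curve c p i t) k) has_real_derivative (if k = i then 1 else 0))
    (at (snd c p i))"
proof -
  have "eventually (\<lambda>t. snd c (coord_curve c p i t) k = ((snd c p)(i := t)) k) (nhds (snd c p i))"
    using coord_curve_in_chart[OF c _ order_refl p i] c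
    by (auto simp: chart_opens_to_boxes_def elim: eventually_mono)
  moreover have "((\<lambda>t. ((snd c p)(i := t)) k) has_real_derivative (if k = i then 1 else 0))
    (at (snd c p i))"
    by (cases "k = i") (auto intro!: derivative_eq_intros)
  ultimately show ?thesis using DERIV_cong_ev[OF refl _ refl] by fast
qed

lemma coord_curve_has_velocity:
  assumes M: "smooth_manifold M" and c: "c \<in> charts_at M p" and i: "i < mdim M"
  shows "has_velocity M (coord_curve c p i) (snd c p i) (coord_vector M c p i)"
proof -
  note C = smooth_manifold_chart[OF M c]
  note base = coord_curve_base[OF C(5) C(2)]
  show ?thesis
    using has_velocity_from_chart[OF M, of "coord_curve c p i" "snd c p i" c "\<lambda>k. if k = i then 1 else 0"]
      coord_curve_limitin[OF C(5) C(2) i] coord_curve_chart_deriv[OF C(5) C(2) i] c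
    by (simp add: base coord_vector_def)
qed

lemma coord_vector_chart:
  assumes M: "smooth_manifold M" and c: "c \<in> charts_at M p" and i: "i < mdim M"
  shows "coord_vector M c p i c k = (if k = i then 1 else 0)"
proof (cases "k < mdim M")
  case True
  note C = smooth_manifold_chart[OF M c]
  show ?thesis
    using DERIV_imp_deriv[OF coord_curve_chart_deriv[OF C(5) C(2) i, of k]] True c
    by (simp add: coord_vector_def)
qed (use i in \<open>auto simp: coord_vector_def\<close>)

lemma coord_vector_in_tangent_space:
  assumes M: "smooth_manifold M" and c: "c \<in> charts_at M p" and i: "i < mdim M"
  shows "coord_vector M c p i \<in> tangent_space M p"
  using velocity_in_tangent_space[OF M coord_curve_has_velocity[OF M c i]]
    coord_curve_base smooth_manifold_chart[OF M c] by metis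

text \<open>
  The coordinate vectors span the tangent space. Since they are velocities, a tangent vector for
  every coordinate tuple exists without using the cocycle rule for Jacobian matrices.
\<close>

lemma tangent_expand:
  assumes M: "smooth_manifold M" and c: "c \<in> charts_at M p" and v: "v \<in> tangent_space M p"
  shows "v d j = (\<Sum>i<mdim M. v c i * coord_vector M c p i d j)"
proof (cases "d \<in> charts_at M p \<and> j < mdim M")
  case True
  let ?J = "\<lambda>i. partial i (\<lambda>x. local_expr c d (\<lambda>q. q) x j) (snd c p)"
  have vec: "u d j = (\<Sum>i<mdim M. ?J i * u c i)" if "u \<in> tangent_space M p" for u
    using that True c by (intro tangent_space_change) auto
  have "coord_vector M c p i d j = ?J i" if i: "i < mdim M" for i
    using vec[OF coord_vector_in_tangent_space[OF M c i]] i
    by (simp add: coord_vector_chart[OF M c i] if_distrib sum.delta cong: if_cong)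
  then show ?thesis using vec[OF v] by (simp add: mult.commute)
next
  case False
  then have "v d j = 0" by (rule tangent_space_pad[OF v])
  then show ?thesis using False by (auto simp: coord_vector_def)
qed

lemma subspace_tangent_space: "tangent.subspace (tangent_space M p)"
proof (rule tangent.subspaceI)
  show "0 \<in> tangent_space M p" by (rule tangent_spaceI) auto
next
  fix v w assume v: "v \<in> tangent_space M p" and w: "w \<in> tangent_space M p"
  show "v + w \<in> tangent_space M p"
  proof (rule tangent_spaceI)
    fix c d j assume cd: "c \<in> charts_at M p" "d \<in> charts_at M p" "j < mdim M"
    show "(v + w) d j = (\<Sum>i<mdim M. partial i (\<lambda>x. local_expr c d (\<lambda>q. q) x j) (snd c p) * (v + w) c i)"
      unfolding plus_fun_def tangent_space_change[OF v cd] tangent_space_change[OF w cd]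
      by (simp add: distrib_left sum.distrib)
  qed (simp add: tangent_space_pad[OF v] tangent_space_pad[OF w])
next
  fix r v assume v: "v \<in> tangent_space M p"
  show "r *\<^sub>t v \<in> tangent_space M p"
  proof (rule tangent_spaceI)
    fix c d j assume cd: "c \<in> charts_at M p" "d \<in> charts_at M p" "j < mdim M"
    show "(r *\<^sub>t v) d j = (\<Sum>i<mdim M. partial i (\<lambda>x. local_expr c d (\<lambda>q. q) x j) (snd c p) * (r *\<^sub>t v) c i)"
      unfolding tscale_def tangent_space_change[OF v cd] mult.left_commute[of _ r] sum_distrib_left ..
  qed (simp add: tscale_def tangent_space_pad[OF v])
qed

lemma sum_tangent_apply: "(\<Sum>i\<in>I. (f i :: 'a tangent)) d j = (\<Sum>i\<in>I. f i d j)"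
  by (induction I rule: infinite_finite_induct) auto

lemma tangent_expand_sum:
  assumes M: "smooth_manifold M" and c: "c \<in> charts_at M p" and v: "v \<in> tangent_space M p"
  shows "v = (\<Sum>i<mdim M. v c i *\<^sub>t coord_vector M c p i)"
  unfolding fun_eq_iff sum_tangent_apply tscale_def by (intro allI tangent_expand[OF M c v])

section \<open>Differentials of maps\<close>

lemma differential_sum:
  "differential M N p F (\<lambda>d j. \<Sum>i\<in>I. a i * E i d j) d j = (\<Sum>i\<in>I. a i * differential M N p F (E i) d j)"
proof -
  have "(\<Sum>k<mdim M. D k * (\<Sum>i\<in>I. a i * E i c k)) = (\<Sum>i\<in>I. a i * (\<Sum>k<mdim M. D k * E i c k))"
    for D :: "nat \<Rightarrow> real" and c
    unfolding sum_distrib_left by (subst sum.swap) (simp add: mult_ac)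
  then show ?thesis
    by (cases "d \<in> charts_at N (F p) \<and> j < mdim N") (auto simp: differential_def dir_deriv_def Let_def)
qed

lemma differential_add: "differential M N p F (u + v) = differential M N p F u + differential M N p F v"
  by (intro ext) (auto simp: differential_def dir_deriv_def Let_def sum.distrib algebra_simps)

lemma differential_scale: "differential M N p F (r *\<^sub>t v) = r *\<^sub>t differential M N p F v"
  by (intro ext) (auto simp: differential_def dir_deriv_def Let_def tscale_def sum_distrib_left algebra_simps)

text \<open>
  A substitute for smoothness whose closure under composition follows from the linearity of
  differentials. Translations and conjugations of a Lie group have this property, which spares a proof
  that smoothness in the sense of iterated partial derivatives is preserved by composition.
\<close>

definition curve_differentiable :: "'a manifold \<Rightarrow> 'b manifold \<Rightarrow> ('a \<Rightarrow> 'b) \<Rightarrow> bool" where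
  "curve_differentiable M N F \<longleftrightarrow> continuous_map (mtop M) (mtop N) F \<and>
     (\<forall>\<gamma> t0 v. has_velocity M \<gamma> t0 v \<longrightarrow>
        has_velocity N (\<lambda>t. F (\<gamma> t)) t0 (differential M N (\<gamma> t0) F v))"

lemma curve_differentiableD:
  "curve_differentiable M N F \<Longrightarrow> has_velocity M \<gamma> t0 v \<Longrightarrow>
    has_velocity N (\<lambda>t. F (\<gamma> t)) t0 (differential M N (\<gamma> t0) F v)"
  by (simp add: curve_differentiable_def)

text \<open>
  Any linear formula for the derivative along curves, in whichever chart, must be the differential:
  both agree on the coordinate vectors of the chart that \<^const>\<open>dir_deriv\<close> chooses.
\<close>

lemma curve_differentiableI:
  assumes M: "smooth_manifold M" and F: "continuous_map (mtop M) (mtop N) F"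
    and lin: "\<And>p d j. p \<in> topspace (mtop M) \<Longrightarrow> d \<in> charts_at N (F p) \<Longrightarrow> j < mdim N \<Longrightarrow>
      \<exists>c\<in>charts_at M p. \<exists>l. \<forall>\<gamma> t0 v. \<gamma> t0 = p \<and> has_velocity M \<gamma> t0 v \<longrightarrow>
        ((\<lambda>t. snd d (F (\<gamma> t)) j) has_real_derivative (\<Sum>k<mdim M. l k * v c k)) (at t0)"
  shows "curve_differentiable M N F"
  unfolding curve_differentiable_def
proof (intro conjI F allI impI)
  fix \<gamma> t0 v assume v: "has_velocity M \<gamma> t0 v"
  note lim = has_velocity_limitin[OF v]
  define p where "p = \<gamma> t0"
  have p: "p \<in> topspace (mtop M)" using lim by (simp add: limitin_def p_def)
  have vT: "v \<in> tangent_space M p" using velocity_in_tangent_space[OF M v] by (simp add: p_def)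
  define b where "b = (SOME c. c \<in> charts_at M p)"
  have b: "b \<in> charts_at M p" unfolding b_def using charts_at_nonempty[OF M p] by (rule someI_ex)
  note B = smooth_manifold_chart[OF M b]
  show "has_velocity N (\<lambda>t. F (\<gamma> t)) t0 (differential M N (\<gamma> t0) F v)"
    unfolding has_velocity_def
  proof (intro conjI allI)
    show "limitin (mtop N) (\<lambda>t. F (\<gamma> t)) (F (\<gamma> t0)) (at t0)"
      using continuous_map_limit[OF F lim] by (simp add: o_def)
    fix d j
    have "((\<lambda>t. snd d (F (\<gamma> t)) j) has_real_derivative differential M N p F v d j) (at t0)"
      if dj: "d \<in> charts_at N (F p)" "j < mdim N"
    proof -
      obtain c l where c: "c \<in> charts_at M p" and l: "\<And>\<gamma> t0 v. \<gamma> t0 = p \<Longrightarrow> has_velocity M \<gamma> t0 v \<Longrightarrow>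
        ((\<lambda>t. snd d (F (\<gamma> t)) j) has_real_derivative (\<Sum>k<mdim M. l k * v c k)) (at t0)"
        using lin[OF p dj] by blast
      have "partial i (\<lambda>x. snd d (F (inv_into (fst b) (snd b) x)) j) (snd b p)
          = (\<Sum>k<mdim M. l k * coord_vector M b p i c k)" if i: "i < mdim M" for i
        using DERIV_imp_deriv[OF l[OF coord_curve_base[OF B(5) B(2)] coord_curve_has_velocity[OF M b i]]]
        by (simp add: partial_def coord_curve_def)
      then have "differential M N p F v d j =
          (\<Sum>i<mdim M. \<Sum>k<mdim M. l k * coord_vector M b p i c k * v b i)"
        using dj by (simp add: differential_def dir_deriv_def Let_def b_def[symmetric] sum_distrib_right)
      also have "\<dots> = (\<Sum>k<mdim M. l k * (\<Sum>i<mdim M. v b i * coord_vector M b p i c k))"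
        by (subst sum.swap) (simp add: sum_distrib_left mult_ac)
      also have "\<dots> = (\<Sum>k<mdim M. l k * v c k)"
        by (simp add: tangent_expand[OF M b vT, symmetric])
      finally show ?thesis using l[OF _ v] by (simp add: p_def)
    qed
    then show "if d \<in> charts_at N (F (\<gamma> t0)) \<and> j < mdim N
       then ((\<lambda>t. snd d (F (\<gamma> t)) j) has_real_derivative differential M N (\<gamma> t0) F v d j) (at t0)
       else differential M N (\<gamma> t0) F v d j = 0"
      by (auto simp: p_def differential_def)
  qed
qed

lemma smooth_map_imp_curve_differentiable:
  assumes M: "smooth_manifold M" and N: "smooth_manifold N" and F: "smooth_map M N F"
  shows "curve_differentiable M N F"
proof (rule curve_differentiableI[OF M])
  show "continuous_map (mtop M) (mtop N) F" using F by (simp add: smooth_map_def)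
  fix p d j assume p: "p \<in> topspace (mtop M)" and d: "d \<in> charts_at N (F p)" and j: "j < mdim N"
  obtain c where c: "c \<in> charts_at M p" using charts_at_nonempty[OF M p] by blast
  note C = smooth_manifold_chart[OF M c] and D = smooth_manifold_chart[OF N d]
  show "\<exists>c\<in>charts_at M p. \<exists>l. \<forall>\<gamma> t0 v. \<gamma> t0 = p \<and> has_velocity M \<gamma> t0 v \<longrightarrow>
        ((\<lambda>t. snd d (F (\<gamma> t)) j) has_real_derivative (\<Sum>k<mdim M. l k * v c k)) (at t0)"
  proof (intro bexI[OF _ c] exI allI impI, elim conjE)
    fix \<gamma> t0 v assume "\<gamma> t0 = p" and v: "has_velocity M \<gamma> t0 v"
    then show "((\<lambda>t. snd d (F (\<gamma> t)) j) has_real_derivative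
        (\<Sum>k<mdim M. partial k (\<lambda>x. local_expr c d F x j) (snd c p) * v c k)) (at t0)"
      using smooth_map_along_curve[OF F C(1) C(5) _ D(1) D(4) _ has_velocity_limitin[OF v] _ j]
        C D c has_velocity_deriv[OF v] by blast
  qed
qed

lemma differential_in_tangent_space:
  assumes M: "smooth_manifold M" and N: "smooth_manifold N" and F: "curve_differentiable M N F"
    and p: "p \<in> topspace (mtop M)" and v: "v \<in> tangent_space M p"
  shows "differential M N p F v \<in> tangent_space N (F p)"
proof -
  obtain c where c: "c \<in> charts_at M p" using charts_at_nonempty[OF M p] by blast
  note C = smooth_manifold_chart[OF M c]
  note base = coord_curve_base[OF C(5) C(2)]
  have E: "differential M N p F (coord_vector M c p i) \<in> tangent_space N (F p)" if "i < mdim M" for i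
    using velocity_in_tangent_space[OF N curve_differentiableD[OF F coord_curve_has_velocity[OF M c that]]]
    by (simp add: base)
  have "differential M N p F v = (\<Sum>i<mdim M. v c i *\<^sub>t differential M N p F (coord_vector M c p i))"
  proof (intro ext)
    fix d j
    have "v = (\<lambda>d j. \<Sum>i<mdim M. v c i * coord_vector M c p i d j)"
      by (intro ext tangent_expand[OF M c v])
    then show "differential M N p F v d j =
        (\<Sum>i<mdim M. v c i *\<^sub>t differential M N p F (coord_vector M c p i)) d j"
      using differential_sum[of M N p F "v c" "coord_vector M c p" "{..<mdim M}" d j]
      by (simp add: sum_tangent_apply tscale_def)
  qed
  also have "\<dots> \<in> tangent_space N (F p)"
    using E by (intro tangent.subspace_sum subspace_tangent_space tangent.subspace_scale) auto
  finally show ?thesis .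
qed

text \<open>
  The differential is defined through one chosen chart; along coordinate lines of another chart it
  has the same expression.
\<close>

lemma differential_in_chart:
  assumes M: "smooth_manifold M" and F: "curve_differentiable M N F"
    and c: "c \<in> charts_at M p" and d: "d \<in> charts_at N (F p)" "j < mdim N"
    and v: "v \<in> tangent_space M p"
  shows "differential M N p F v d j =
    (\<Sum>i<mdim M. v c i * partial i (\<lambda>x. snd d (F (inv_into (fst c) (snd c) x)) j) (snd c p))"
proof -
  note C = smooth_manifold_chart[OF M c]
  note base = coord_curve_base[OF C(5) C(2)]
  have "partial i (\<lambda>x. snd d (F (inv_into (fst c) (snd c) x)) j) (snd c p) =
      differential M N p F (coord_vector M c p i) d j" if "i < mdim M" for i
    using has_velocity_deriv[OF curve_differentiableD[OF F coord_curve_has_velocity[OF M c that]], of d j, unfolded base] d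
    by (simp add: partial_def coord_curve_def DERIV_imp_deriv)
  moreover have "v = (\<lambda>d j. \<Sum>i<mdim M. v c i * coord_vector M c p i d j)"
    by (intro ext tangent_expand[OF M c v])
  then have "differential M N p F v d j = (\<Sum>i<mdim M. v c i * differential M N p F (coord_vector M c p i) d j)"
    using differential_sum[of M N p F "v c" "coord_vector M c p" "{..<mdim M}" d j] by simp
  ultimately show ?thesis by simp
qed

text \<open>
  It suffices to compare both sides on coordinate vectors, which are velocities of coordinate lines,
  and there the definition of curve-differentiability applies twice.
\<close>

lemma differential_comp:
  assumes M: "smooth_manifold M" and N: "smooth_manifold N"
    and F: "curve_differentiable M N F" and G: "curve_differentiable N P G"
    and p: "p \<in> topspace (mtop M)" and v: "v \<in> tangent_space M p"
  shows "differential M P p (\<lambda>x. G (F x)) v = differential N P (F p) G (differential M N p F v)"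
proof (intro ext)
  fix d j
  define c where "c = (SOME c. c \<in> charts_at M p)"
  have c: "c \<in> charts_at M p" unfolding c_def using charts_at_nonempty[OF M p] by (rule someI_ex)
  note C = smooth_manifold_chart[OF M c]
  note base = coord_curve_base[OF C(5) C(2)]
  let ?E = "coord_vector M c p"
  let ?GF = "\<lambda>u. differential N P (F p) G (differential M N p F u)"
  have part: "partial i (\<lambda>x. snd d (G (F (inv_into (fst c) (snd c) x))) j) (snd c p) = ?GF (?E i) d j"
    if i: "i < mdim M" and dj: "d \<in> charts_at P (G (F p))" "j < mdim P" for i
    using has_velocity_deriv[OF curve_differentiableD[OF G
      curve_differentiableD[OF F coord_curve_has_velocity[OF M c i]]], of d j, unfolded base] dj
    by (simp add: partial_def coord_curve_def DERIV_imp_deriv)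
  have v': "v = (\<lambda>d j. \<Sum>i<mdim M. v c i * ?E i d j)"
    by (intro ext tangent_expand[OF M c v])
  have dF: "differential M N p F v = (\<lambda>d j. \<Sum>i<mdim M. v c i * differential M N p F (?E i) d j)"
    by (subst v') (intro ext differential_sum)
  have GF: "?GF v d j = (\<Sum>i<mdim M. v c i * ?GF (?E i) d j)"
    by (subst dF) (rule differential_sum)
  show "differential M P p (\<lambda>x. G (F x)) v d j = ?GF v d j"
  proof (cases "d \<in> charts_at P (G (F p)) \<and> j < mdim P")
    case True
    then have "differential M P p (\<lambda>x. G (F x)) v d j = (\<Sum>i<mdim M. ?GF (?E i) d j * v c i)"
      using part by (simp add: differential_def[of M P] dir_deriv_def[of M] Let_def c_def[symmetric])
    then show ?thesis unfolding GF by (simp add: mult.commute)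
  qed (auto simp: differential_def)
qed

lemma curve_differentiable_comp:
  assumes M: "smooth_manifold M" and N: "smooth_manifold N"
    and F: "curve_differentiable M N F" and G: "curve_differentiable N P G"
  shows "curve_differentiable M P (\<lambda>x. G (F x))"
  unfolding curve_differentiable_def
proof (intro conjI allI impI)
  show "continuous_map (mtop M) (mtop P) (\<lambda>x. G (F x))"
    using F G continuous_map_compose[of _ _ F _ G] by (auto simp: curve_differentiable_def o_def)
  fix \<gamma> t0 v assume v: "has_velocity M \<gamma> t0 v"
  have "\<gamma> t0 \<in> topspace (mtop M)" using has_velocity_limitin[OF v] by (simp add: limitin_def)
  with differential_comp[OF M N F G this velocity_in_tangent_space[OF M v]]
    curve_differentiableD[OF G curve_differentiableD[OF F v]]
  show "has_velocity P (\<lambda>t. G (F (\<gamma> t))) t0 (differential M P (\<gamma> t0) (\<lambda>x. G (F x)) v)"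
    by simp
qed


section \<open>Multiplication and the adjoint representation\<close>

lemma DERIV_eventually_eq:
  "(f has_real_derivative D) (at x) \<Longrightarrow> eventually (\<lambda>t. f t = g t) (nhds x) \<Longrightarrow>
    (g has_real_derivative D) (at x)"
  using DERIV_cong_ev[OF refl _ refl] by blast

lemma sum_lessThan_add: "(\<Sum>i<n + m. f i) = (\<Sum>i<n. f i) + (\<Sum>k<m. f (n + k :: nat) :: real)"
  by (induction m) (auto simp: add.assoc)

lemma prod_chart_apply: "snd (prod_chart n c d) (p, q) i = (if i < n then snd c p i else snd d q (i - n))"
  by (simp add: prod_chart_def)

lemma chart_zero_beyond_dim:
  assumes "chart_opens_to_boxes M c" "p \<in> fst c" "i \<ge> mdim M"
  shows "snd c p i = 0"
proof -
  have "coord_nhd (mdim M) (snd c p) (snd c ` fst c)"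
    using assms unfolding chart_opens_to_boxes_def by blast
  then show ?thesis using assms(3) by (simp add: coord_nhd_def)
qed

lemma prod_chart_opens_to_boxes:
  assumes c: "chart_opens_to_boxes M c" and d: "chart_opens_to_boxes N d"
  shows "chart_opens_to_boxes (prod_manifold M N) (prod_chart (mdim M) c d)"
  unfolding chart_opens_to_boxes_def
proof (intro conjI allI impI, goal_cases)
  let ?n = "mdim M" and ?m = "mdim N"
  let ?P = "prod_chart ?n c d"
  have fst: "fst ?P = fst c \<times> fst d" by (simp add: prod_chart_def)
  {
    case 1
    then show ?case
      using c d by (simp add: fst prod_manifold_def chart_opens_to_boxes_def openin_prod_Times_iff)
  next
    case 2
    show ?case
    proof (rule inj_onI, unfold fst)
      fix z z' assume z: "z \<in> fst c \<times> fst d" "z' \<in> fst c \<times> fst d" and eq: "snd ?P z = snd ?P z'"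
      obtain p q p' q' where pq: "z = (p, q)" "z' = (p', q')" by (metis surj_pair)
      have "snd c p i = snd c p' i" for i
        using fun_cong[OF eq, of i] z chart_zero_beyond_dim[OF c, of _ i]
        by (cases "i < ?n") (auto simp: pq prod_chart_apply)
      moreover have "snd d q i = snd d q' i" for i
        using fun_cong[OF eq, of "?n + i"] by (simp add: pq prod_chart_apply)
      ultimately have "snd c p = snd c p'" "snd d q = snd d q'" by auto
      then show "z = z'"
        using z c d by (auto simp: pq chart_opens_to_boxes_def dest: inj_onD)
    qed
  next
    case (3 V z)
    obtain p q where z: "z = (p, q)" by (metis surj_pair)
    have "openin (prod_topology (mtop M) (mtop N)) V" "(p, q) \<in> V"
      using 3 by (simp_all add: prod_manifold_def z)
    then obtain A B where AB: "openin (mtop M) A" "openin (mtop N) B" "p \<in> A" "q \<in> B" "A \<times> B \<subseteq> V"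
      unfolding openin_prod_topology_alt by meson
    have "A \<subseteq> fst c" "B \<subseteq> fst d" using AB 3 fst by blast+
    then have A: "coord_nhd ?n (snd c p) (snd c ` A)" and B: "coord_nhd ?m (snd d q) (snd d ` B)"
      using c d AB by (auto simp: chart_opens_to_boxes_def)
    obtain e1 where e1: "e1 > 0" "\<And>y. (\<forall>i<?n. \<bar>y i - snd c p i\<bar> < e1) \<and> (\<forall>i\<ge>?n. y i = 0) \<Longrightarrow> y \<in> snd c ` A"
      using A unfolding coord_nhd_def by blast
    obtain e2 where e2: "e2 > 0" "\<And>y. (\<forall>i<?m. \<bar>y i - snd d q i\<bar> < e2) \<and> (\<forall>i\<ge>?m. y i = 0) \<Longrightarrow> y \<in> snd d ` B"
      using B unfolding coord_nhd_def by blast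
    show ?case
      unfolding coord_nhd_def z
    proof (intro conjI exI[of _ "min e1 e2"] allI impI)
      show "0 < min e1 e2" using e1 e2 by simp
      show "snd ?P (p, q) i = 0" if "i \<ge> mdim (prod_manifold M N)" for i
        using that B by (auto simp: prod_chart_apply prod_manifold_def coord_nhd_def)
      fix y assume y: "(\<forall>i<mdim (prod_manifold M N). \<bar>y i - snd ?P (p, q) i\<bar> < min e1 e2) \<and>
        (\<forall>i\<ge>mdim (prod_manifold M N). y i = 0)"
      have "(\<lambda>i. if i < ?n then y i else 0) \<in> snd c ` A"
      proof (rule e1(2), intro conjI allI impI)
        fix i assume "i < ?n"
        then show "\<bar>(if i < ?n then y i else 0) - snd c p i\<bar> < e1"
          using conjunct1[OF y, rule_format, of i] by (simp add: prod_manifold_def prod_chart_apply)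
      qed auto
      then obtain a where a: "a \<in> A" "snd c a = (\<lambda>i. if i < ?n then y i else 0)" by auto
      have "(\<lambda>i. y (?n + i)) \<in> snd d ` B"
      proof (rule e2(2), intro conjI allI impI)
        fix i assume "i < ?m"
        then show "\<bar>y (?n + i) - snd d q i\<bar> < e2"
          using conjunct1[OF y, rule_format, of "?n + i"] by (simp add: prod_manifold_def prod_chart_apply)
      next
        fix i assume "?m \<le> i"
        then show "y (?n + i) = 0" using y by (simp add: prod_manifold_def)
      qed
      then obtain b where b: "b \<in> B" "snd d b = (\<lambda>i. y (?n + i))" by auto
      have "y = snd ?P (a, b)"
        using a b by (auto simp: prod_chart_apply)
      then show "y \<in> snd ?P ` V" using a b AB by blast
    qed
  }
qed

lemma prod_chart_in_atlas:
  "c \<in> atlas M \<Longrightarrow> d \<in> atlas N \<Longrightarrow> prod_chart (mdim M) c d \<in> atlas (prod_manifold M N)"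
  unfolding prod_manifold_def by (simp del: split_paired_Ex) blast

lemma has_velocity_const:
  assumes M: "smooth_manifold M" and "p \<in> topspace (mtop M)"
  shows "has_velocity M (\<lambda>_. p) t0 0"
  using assms by (auto simp: has_velocity_def limitin_const_iff)

lemma differential_cong:
  fixes M :: "'a manifold" and N :: "'b manifold"
  assumes M: "smooth_manifold M" and p: "p \<in> topspace (mtop M)"
    and eq: "\<And>q. q \<in> topspace (mtop M) \<Longrightarrow> F q = G q"
  shows "differential M N p F = differential M N p G"
proof (intro ext)
  fix v :: "'a tangent" and d :: "'b chart" and j
  define c where "c = (SOME c. c \<in> charts_at M p)"
  have c: "c \<in> charts_at M p" unfolding c_def using charts_at_nonempty[OF M p] by (rule someI_ex)
  note C = smooth_manifold_chart[OF M c]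
  have "partial i (\<lambda>x. snd d (F (inv_into (fst c) (snd c) x)) j) (snd c p) =
      partial i (\<lambda>x. snd d (G (inv_into (fst c) (snd c) x)) j) (snd c p)" if i: "i < mdim M" for i
    unfolding partial_def
  proof (rule deriv_cong_ev[OF _ refl])
    have "eventually (\<lambda>t. coord_curve c p i t \<in> fst c) (nhds (snd c p i))"
      using coord_curve_in_chart[OF C(5) C(4) order_refl C(2) i] by (rule eventually_mono) simp
    then show "eventually (\<lambda>t. snd d (F (inv_into (fst c) (snd c) ((snd c p)(i := t)))) j =
        snd d (G (inv_into (fst c) (snd c) ((snd c p)(i := t)))) j) (nhds (snd c p i))"
    proof (rule eventually_mono)
      fix t assume "coord_curve c p i t \<in> fst c"
      then have "F (coord_curve c p i t) = G (coord_curve c p i t)"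
        using openin_subset[OF C(4)] by (intro eq) auto
      then show "snd d (F (inv_into (fst c) (snd c) ((snd c p)(i := t)))) j =
        snd d (G (inv_into (fst c) (snd c) ((snd c p)(i := t)))) j"
        by (simp add: coord_curve_def)
    qed
  qed
  then show "differential M N p F v d j = differential M N p G v d j"
    by (simp add: differential_def dir_deriv_def Let_def c_def[symmetric] eq[OF p])
qed

lemma differential_id:
  assumes M: "smooth_manifold M" and p: "p \<in> topspace (mtop M)" and v: "v \<in> tangent_space M p"
  shows "differential M M p (\<lambda>q. q) v = v"
proof -
  obtain c where c: "c \<in> charts_at M p" using charts_at_nonempty[OF M p] by blast
  note C = smooth_manifold_chart[OF M c]
  have id: "curve_differentiable M M (\<lambda>q. q)"
    using M by (intro smooth_map_imp_curve_differentiable) (auto simp: smooth_manifold_def)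
  have E: "differential M M p (\<lambda>q. q) (coord_vector M c p i) = coord_vector M c p i" if i: "i < mdim M" for i
    using curve_differentiableD[OF id coord_curve_has_velocity[OF M c i]]
      coord_curve_has_velocity[OF M c i] has_velocity_unique
    unfolding coord_curve_base[OF C(5) C(2)] by blast
  show ?thesis
  proof (intro ext)
    fix d j
    have "v = (\<lambda>d j. \<Sum>i<mdim M. v c i * coord_vector M c p i d j)"
      by (intro ext tangent_expand[OF M c v])
    then have "differential M M p (\<lambda>q. q) v d j =
        (\<Sum>i<mdim M. v c i * differential M M p (\<lambda>q. q) (coord_vector M c p i) d j)"
      using differential_sum[of M M p "\<lambda>q. q" "v c" "coord_vector M c p" "{..<mdim M}" d j] by simp
    also have "\<dots> = (\<Sum>i<mdim M. v c i * coord_vector M c p i d j)" using E by simp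
    also have "\<dots> = v d j" by (rule tangent_expand[OF M c v, symmetric])
    finally show "differential M M p (\<lambda>q. q) v d j = v d j" .
  qed
qed

locale lie = fixes K :: "'a lie_struct" (structure)
  assumes lie_group: "lie_group K"
begin

sublocale group K
  using lie_group by (simp add: lie_group_def)

abbreviation M :: "'a manifold" where "M \<equiv> mfld K"
abbreviation n :: nat where "n \<equiv> mdim (mfld K)"

lemma M: "smooth_manifold M" and top [simp]: "topspace (mtop M) = carrier K"
  and mult_smooth: "smooth_map (prod_manifold M M) M (\<lambda>(x, y). x \<otimes> y)"
  and inv_smooth: "smooth_map M M (\<lambda>x. inv x)"
  using lie_group by (auto simp: lie_group_def)

lemma mult_along_curves:
  assumes v: "has_velocity M \<gamma> t0 v" and w: "has_velocity M \<delta> t0 w"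
    and c: "c \<in> charts_at M (\<gamma> t0)" and c': "c' \<in> charts_at M (\<delta> t0)"
    and d: "d \<in> charts_at M (\<gamma> t0 \<otimes> \<delta> t0)" and j: "j < n"
  defines "f \<equiv> \<lambda>z. local_expr (prod_chart n c c') d (\<lambda>(x, y). x \<otimes> y) z j"
    and "z0 \<equiv> snd (prod_chart n c c') (\<gamma> t0, \<delta> t0)"
  shows "((\<lambda>t. snd d (\<gamma> t \<otimes> \<delta> t) j) has_real_derivative
    (\<Sum>i<n. partial i f z0 * v c i) + (\<Sum>k<n. partial (n + k) f z0 * w c' k)) (at t0)"
proof -
  note C = smooth_manifold_chart[OF M c] and C' = smooth_manifold_chart[OF M c']
    and D = smooth_manifold_chart[OF M d]
  let ?P = "prod_chart n c c'"
  have "((\<lambda>t. snd d ((\<lambda>(x, y). x \<otimes> y) (\<gamma> t, \<delta> t)) j) has_real_derivative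
    (\<Sum>i<mdim (prod_manifold M M). partial i f z0 * (if i < n then v c i else w c' (i - n)))) (at t0)"
    unfolding f_def z0_def
  proof (rule smooth_map_along_curve[OF mult_smooth _ _ _ D(1) D(4)])
    show "?P \<in> atlas (prod_manifold M M)" using C(1) C'(1) by (intro prod_chart_in_atlas)
    show "chart_opens_to_boxes (prod_manifold M M) ?P"
      using C C' by (intro prod_chart_opens_to_boxes)
    show "(\<gamma> t0, \<delta> t0) \<in> fst ?P" using C C' by (simp add: prod_chart_def)
    show "limitin (mtop (prod_manifold M M)) (\<lambda>t. (\<gamma> t, \<delta> t)) (\<gamma> t0, \<delta> t0) (at t0)"
      using has_velocity_limitin[OF v] has_velocity_limitin[OF w]
      by (simp add: prod_manifold_def limitin_pairwise o_def)
    show "((\<lambda>t. snd ?P (\<gamma> t, \<delta> t) i) has_real_derivative (if i < n then v c i else w c' (i - n))) (at t0)"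
      if "i < mdim (prod_manifold M M)" for i
      using that has_velocity_deriv[OF v c, of i] has_velocity_deriv[OF w c', of "i - n"]
      by (auto simp: prod_chart_apply prod_manifold_def)
  qed (use D j in auto)
  then show ?thesis by (simp add: prod_manifold_def sum_lessThan_add)
qed

lemma left_mult_curve_differentiable:
  assumes x: "x \<in> carrier K"
  shows "curve_differentiable M M (\<lambda>y. x \<otimes> y)"
proof (rule curve_differentiableI[OF M])
  show "continuous_map (mtop M) (mtop M) (\<lambda>y. x \<otimes> y)"
    using continuous_map_compose[of "mtop M" "prod_topology (mtop M) (mtop M)" "\<lambda>y. (x, y)" "mtop M" "\<lambda>(x, y). x \<otimes> y"]
      mult_smooth x by (auto simp: smooth_map_def prod_manifold_def o_def continuous_map_pairedI)
  fix p d j assume p: "p \<in> topspace (mtop M)" and d: "d \<in> charts_at M (x \<otimes> p)" and j: "j < n"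
  obtain c where c: "c \<in> charts_at M x" using charts_at_nonempty[OF M, of x] x unfolding top by blast
  obtain c' where c': "c' \<in> charts_at M p" using charts_at_nonempty[OF M p] by blast
  show "\<exists>c\<in>charts_at M p. \<exists>l. \<forall>\<gamma> t0 v. \<gamma> t0 = p \<and> has_velocity M \<gamma> t0 v \<longrightarrow>
        ((\<lambda>t. snd d (x \<otimes> \<gamma> t) j) has_real_derivative (\<Sum>k<n. l k * v c k)) (at t0)"
  proof (intro bexI[OF _ c'] exI allI impI, elim conjE)
    fix \<gamma> t0 v assume "\<gamma> t0 = p" and v: "has_velocity M \<gamma> t0 v"
    then show "((\<lambda>t. snd d (x \<otimes> \<gamma> t) j) has_real_derivative
        (\<Sum>k<n. partial (n + k) (\<lambda>z. local_expr (prod_chart n c c') d (\<lambda>(x, y). x \<otimes> y) z j)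
          (snd (prod_chart n c c') (x, p)) * v c' k)) (at t0)"
      using mult_along_curves[OF has_velocity_const[OF M] v, of x c c' d j] x c c' d j by simp
  qed
qed

lemma right_mult_curve_differentiable:
  assumes x: "x \<in> carrier K"
  shows "curve_differentiable M M (\<lambda>y. y \<otimes> x)"
proof (rule curve_differentiableI[OF M])
  show "continuous_map (mtop M) (mtop M) (\<lambda>y. y \<otimes> x)"
    using continuous_map_compose[of "mtop M" "prod_topology (mtop M) (mtop M)" "\<lambda>y. (y, x)" "mtop M" "\<lambda>(x, y). x \<otimes> y"]
      mult_smooth x by (auto simp: smooth_map_def prod_manifold_def o_def continuous_map_pairedI)
  fix p d j assume p: "p \<in> topspace (mtop M)" and d: "d \<in> charts_at M (p \<otimes> x)" and j: "j < n"
  obtain c where c: "c \<in> charts_at M x" using charts_at_nonempty[OF M, of x] x unfolding top by blast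
  obtain c' where c': "c' \<in> charts_at M p" using charts_at_nonempty[OF M p] by blast
  show "\<exists>c\<in>charts_at M p. \<exists>l. \<forall>\<gamma> t0 v. \<gamma> t0 = p \<and> has_velocity M \<gamma> t0 v \<longrightarrow>
        ((\<lambda>t. snd d (\<gamma> t \<otimes> x) j) has_real_derivative (\<Sum>k<n. l k * v c k)) (at t0)"
  proof (intro bexI[OF _ c'] exI allI impI, elim conjE)
    fix \<gamma> t0 v assume "\<gamma> t0 = p" and v: "has_velocity M \<gamma> t0 v"
    then show "((\<lambda>t. snd d (\<gamma> t \<otimes> x) j) has_real_derivative
        (\<Sum>k<n. partial k (\<lambda>z. local_expr (prod_chart n c' c) d (\<lambda>(x, y). x \<otimes> y) z j)
          (snd (prod_chart n c' c) (p, x)) * v c' k)) (at t0)"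
      using mult_along_curves[OF v has_velocity_const[OF M], of x c' c d j] x c c' d j by simp
  qed
qed

lemma conj_curve_differentiable:
  "x \<in> carrier K \<Longrightarrow> curve_differentiable M M (\<lambda>y. x \<otimes> y \<otimes> inv x)"
  using curve_differentiable_comp[OF M M left_mult_curve_differentiable right_mult_curve_differentiable]
  by simp

lemma one_in_top: "\<one> \<in> topspace (mtop M)" by simp

lemma Ad_in_lie_algebra:
  assumes x: "x \<in> carrier K" and v: "v \<in> lie_algebra K"
  shows "Ad K x v \<in> lie_algebra K"
  using differential_in_tangent_space[OF M M conj_curve_differentiable[OF x] one_in_top, of v] x v
  by (simp add: Ad_def lie_algebra_def)

lemma Ad_one: "v \<in> lie_algebra K \<Longrightarrow> Ad K \<one> v = v"
  using differential_cong[OF M one_in_top, of "\<lambda>y. \<one> \<otimes> y \<otimes> inv \<one>" "\<lambda>y. y" M] differential_id[OF M one_in_top]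
  by (simp add: Ad_def lie_algebra_def)

lemma Ad_eq_right_left:
  assumes x: "x \<in> carrier K" and v: "v \<in> lie_algebra K"
  shows "Ad K x v = differential M M x (\<lambda>y. y \<otimes> inv x) (differential M M \<one> (\<lambda>y. x \<otimes> y) v)"
  using differential_comp[OF M M left_mult_curve_differentiable[OF x]
    right_mult_curve_differentiable one_in_top, of "inv x" v] x v
  by (simp add: Ad_def lie_algebra_def)

text \<open>
  Right translation by \<open>x\<close> undoes the factor \<open>inv x\<close> of the conjugation. This relation involves \<open>Ad\<close>
  linearly and contains no inverse, so it can be differentiated with respect to \<open>x\<close>.
\<close>

lemma right_differential_Ad:
  assumes x: "x \<in> carrier K" and v: "v \<in> lie_algebra K"
  shows "differential M M \<one> (\<lambda>y. y \<otimes> x) (Ad K x v) = differential M M \<one> (\<lambda>y. x \<otimes> y) v"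
proof -
  have "differential M M \<one> (\<lambda>y. x \<otimes> y) = differential M M \<one> (\<lambda>y. x \<otimes> y \<otimes> inv x \<otimes> x)"
    by (rule differential_cong[OF M one_in_top]) (use x in \<open>simp add: m_assoc\<close>)
  then show ?thesis
    using differential_comp[OF M M conj_curve_differentiable[OF x]
      right_mult_curve_differentiable[OF x] one_in_top, of v] x v
    by (simp add: Ad_def lie_algebra_def)
qed

section \<open>The bracket as a derivative of the adjoint action\<close>

text \<open>
  This is the very chart that \<^const>\<open>dir_deriv\<close> chooses at the identity, so that brackets and \<open>Ad\<close> unfold
  to coordinates in it.
\<close>

definition c0 :: "'a chart" where "c0 = (SOME c. c \<in> charts_at M \<one>)"
definition origin :: "nat \<Rightarrow> real" where "origin = snd c0 \<one>"
definition par :: "(nat \<Rightarrow> real) \<Rightarrow> 'a" where "par = inv_into (fst c0) (snd c0)"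
definition axis :: "nat \<Rightarrow> real \<Rightarrow> 'a" where "axis = coord_curve c0 \<one>"
definition basis :: "nat \<Rightarrow> 'a tangent" where "basis = coord_vector M c0 \<one>"

text \<open>
  Multiplication in coordinates, a function of \<open>2 n\<close> variables: the first factor occupies the
  coordinates \<open>0, \<dots>, n - 1\<close> and the second one the coordinates \<open>n, \<dots>, 2 n - 1\<close>.
\<close>

definition mult_expr :: "'a chart \<Rightarrow> nat \<Rightarrow> (nat \<Rightarrow> real) \<Rightarrow> real" where
  "mult_expr d j z = local_expr (prod_chart n c0 c0) d (\<lambda>(x, y). x \<otimes> y) z j"
definition pair_coord :: "'a \<Rightarrow> 'a \<Rightarrow> nat \<Rightarrow> real" where
  "pair_coord x y = snd (prod_chart n c0 c0) (x, y)"

lemma c0: "c0 \<in> charts_at M \<one>"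
  unfolding c0_def using charts_at_nonempty[OF M one_in_top] by (rule someI_ex)

lemmas C0 = smooth_manifold_chart[OF M c0]

lemma c0_subset: "fst c0 \<subseteq> carrier K"
  using openin_subset[OF C0(4)] by simp

lemma axis_origin: "axis i (origin i) = \<one>"
  by (simp add: axis_def origin_def coord_curve_base[OF C0(5) C0(2)])

lemma axis_eq: "axis i t = par (origin(i := t))"
  by (simp add: axis_def par_def coord_curve_def origin_def)

lemma axis_eventually:
  assumes "i < n" "openin (mtop M) V" "\<one> \<in> V"
  shows "eventually (\<lambda>t. axis i t \<in> V \<and> axis i t \<in> fst c0 \<and> snd c0 (axis i t) = origin(i := t)) (nhds (origin i))"
  using coord_curve_in_chart[OF C0(5), of "V \<inter> fst c0" \<one> i] assms C0 openin_Int[OF assms(2) C0(4)]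
  by (auto simp: axis_def origin_def elim: eventually_mono)

lemma pair_coord_apply: "pair_coord x y i = (if i < n then snd c0 x i else snd c0 y (i - n))"
  by (simp add: pair_coord_def prod_chart_apply)

lemma mult_expr_pair:
  assumes "x \<in> fst c0" "y \<in> fst c0"
  shows "mult_expr d j (pair_coord x y) = snd d (x \<otimes> y) j"
proof -
  have "inj_on (snd (prod_chart n c0 c0)) (fst (prod_chart n c0 c0))"
    using prod_chart_opens_to_boxes[OF C0(5) C0(5)] by (simp add: chart_opens_to_boxes_def)
  moreover have "(x, y) \<in> fst (prod_chart n c0 c0)" using assms by (simp add: prod_chart_def)
  ultimately show ?thesis
    by (simp add: mult_expr_def local_expr_def pair_coord_def)
qed

lemma coord_curve_c0:
  assumes "x \<in> fst c0" "i < n"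
  shows "eventually (\<lambda>t. par ((snd c0 x)(i := t)) \<in> fst c0 \<and> snd c0 (par ((snd c0 x)(i := t))) = (snd c0 x)(i := t))
    (nhds (snd c0 x i))"
  using coord_curve_in_chart[OF C0(5) C0(4) order_refl assms] by (simp add: coord_curve_def par_def)

lemma partial_mult_expr_fst:
  assumes x: "x \<in> fst c0" and y: "y \<in> fst c0" and i: "i < n"
  shows "partial i (mult_expr d j) (pair_coord x y) = partial i (\<lambda>a. snd d (par a \<otimes> y) j) (snd c0 x)"
  unfolding partial_def
proof (rule deriv_cong_ev)
  show at: "pair_coord x y i = snd c0 x i" using i by (simp add: pair_coord_apply)
  show "\<forall>\<^sub>F t in nhds (pair_coord x y i). mult_expr d j ((pair_coord x y)(i := t)) =
      snd d (par ((snd c0 x)(i := t)) \<otimes> y) j"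
    unfolding at using coord_curve_c0[OF x i]
  proof eventually_elim
    case (elim t)
    let ?x' = "par ((snd c0 x)(i := t))"
    have "(pair_coord x y)(i := t) = pair_coord ?x' y"
      using elim i by (intro ext) (auto simp: pair_coord_apply)
    then show ?case using mult_expr_pair[of ?x' y] elim y by simp
  qed
qed

lemma partial_mult_expr_snd:
  assumes x: "x \<in> fst c0" and y: "y \<in> fst c0" and k: "k < n"
  shows "partial (n + k) (mult_expr d j) (pair_coord x y) = partial k (\<lambda>b. snd d (x \<otimes> par b) j) (snd c0 y)"
  unfolding partial_def
proof (rule deriv_cong_ev)
  show at: "pair_coord x y (n + k) = snd c0 y k" using k by (simp add: pair_coord_apply)
  show "\<forall>\<^sub>F t in nhds (pair_coord x y (n + k)). mult_expr d j ((pair_coord x y)(n + k := t)) =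
      snd d (x \<otimes> par ((snd c0 y)(k := t))) j"
    unfolding at using coord_curve_c0[OF y k]
  proof eventually_elim
    case (elim t)
    let ?y' = "par ((snd c0 y)(k := t))"
    have "(pair_coord x y)(n + k := t) = pair_coord x ?y'"
      using elim k by (intro ext) (auto simp: pair_coord_apply)
    then show ?case using mult_expr_pair[of x ?y'] elim x by simp
  qed
qed

lemma mult_expr_domain:
  assumes x: "x \<in> fst c0" and y: "y \<in> fst c0" and d: "d \<in> charts_at M (x \<otimes> y)"
  shows "coord_nhd (n + n) (pair_coord x y) (local_dom (prod_chart n c0 c0) d (\<lambda>(x, y). x \<otimes> y))"
proof -
  note D = smooth_manifold_chart[OF M d]
  let ?P = "prod_chart n c0 c0" and ?F = "\<lambda>(x, y). x \<otimes> y"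
  let ?X = "mtop (prod_manifold M M)"
  have P: "chart_opens_to_boxes (prod_manifold M M) ?P"
    by (rule prod_chart_opens_to_boxes[OF C0(5) C0(5)])
  have "openin ?X {z \<in> topspace ?X. ?F z \<in> fst d}"
    using mult_smooth D(4) by (auto simp: smooth_map_def intro!: openin_continuous_map_preimage)
  moreover have U: "openin ?X (fst ?P)" using P by (simp add: chart_opens_to_boxes_def)
  ultimately have "openin ?X (fst ?P \<inter> {z \<in> topspace ?X. ?F z \<in> fst d})" by blast
  moreover have "fst ?P \<inter> {z \<in> topspace ?X. ?F z \<in> fst d} = {z \<in> fst ?P. ?F z \<in> fst d}"
    using openin_subset[OF U] by auto
  ultimately have "openin ?X {z \<in> fst ?P. ?F z \<in> fst d}" by simp
  moreover have "{z \<in> fst ?P. ?F z \<in> fst d} \<subseteq> fst ?P" by auto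
  moreover have "(x, y) \<in> {z \<in> fst ?P. ?F z \<in> fst d}"
    using x y D by (simp add: prod_chart_def)
  ultimately have "coord_nhd (mdim (prod_manifold M M)) (snd ?P (x, y)) (snd ?P ` {z \<in> fst ?P. ?F z \<in> fst d})"
    using P unfolding chart_opens_to_boxes_def by blast
  then show ?thesis by (simp add: pair_coord_def local_dom_def prod_manifold_def)
qed

lemma mult_expr_Ck:
  assumes d: "d \<in> atlas M" and j: "j < n"
  shows "Ck_on (n + n) (local_dom (prod_chart n c0 c0) d (\<lambda>(x, y). x \<otimes> y)) k (mult_expr d j)"
proof -
  have "prod_chart n c0 c0 \<in> atlas (prod_manifold M M)" using C0(1) by (intro prod_chart_in_atlas)
  moreover have "mult_expr d j = (\<lambda>z. local_expr (prod_chart n c0 c0) d (\<lambda>(x, y). x \<otimes> y) z j)"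
    by (auto simp: mult_expr_def)
  moreover have "mdim (prod_manifold M M) = n + n" by (simp add: prod_manifold_def)
  ultimately show ?thesis
    using mult_smooth d j unfolding smooth_map_def smooth_on_def by metis
qed

text \<open>
  The matrices, with respect to the charts \<open>c0\<close> and \<open>d\<close>, of the differentials at the identity of left
  and right translation by \<open>x\<close>.
\<close>

definition left_partial :: "'a chart \<Rightarrow> nat \<Rightarrow> nat \<Rightarrow> 'a \<Rightarrow> real" where
  "left_partial d j k x = partial k (\<lambda>b. snd d (x \<otimes> par b) j) origin"

definition right_partial :: "'a chart \<Rightarrow> nat \<Rightarrow> nat \<Rightarrow> 'a \<Rightarrow> real" where
  "right_partial d j k x = partial k (\<lambda>a. snd d (par a \<otimes> x) j) origin"

text \<open>
  The mixed second derivative of \<open>x y\<close> at the identity, in direction \<open>i\<close> in \<open>x\<close> and in direction \<open>k\<close> in \<open>y\<close>.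
\<close>

definition mixed :: "'a chart \<Rightarrow> nat \<Rightarrow> nat \<Rightarrow> nat \<Rightarrow> real" where
  "mixed d j i k = partial i (partial (n + k) (mult_expr d j)) (pair_coord \<one> \<one>)"

lemma left_partial_axis_deriv:
  assumes d: "d \<in> charts_at M \<one>" and j: "j < n" and i: "i < n" and k: "k < n"
  shows "((\<lambda>t. left_partial d j k (axis i t)) has_real_derivative mixed d j i k) (at (origin i))"
proof -
  let ?W = "local_dom (prod_chart n c0 c0) d (\<lambda>(x, y). x \<otimes> y)"
  let ?g = "partial (n + k) (mult_expr d j)"
  have W: "pair_coord \<one> \<one> \<in> ?W"
    using mult_expr_domain[of \<one> \<one> d] C0 d by (simp add: coord_nhd_imp_mem)
  have "Ck_on (n + n) ?W (Suc 0) ?g"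
    using mult_expr_Ck[OF smooth_manifold_chart(1)[OF M d] j, of "Suc (Suc 0)"] k by simp
  then have "((\<lambda>t. ?g ((pair_coord \<one> \<one>)(i := t))) has_real_derivative mixed d j i k) (at (pair_coord \<one> \<one> i))"
    unfolding mixed_def using W i by (intro Ck_on_has_partial[of "n + n" _ 0]) auto
  moreover have "pair_coord \<one> \<one> i = origin i" using i by (simp add: pair_coord_apply origin_def)
  moreover have "eventually (\<lambda>t. ?g ((pair_coord \<one> \<one>)(i := t)) = left_partial d j k (axis i t)) (nhds (origin i))"
    using axis_eventually[OF i C0(4) C0(2)]
  proof eventually_elim
    case (elim t)
    have "(pair_coord \<one> \<one>)(i := t) = pair_coord (axis i t) \<one>"
      using elim i by (intro ext) (auto simp: pair_coord_apply origin_def)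
    then show ?case
      using partial_mult_expr_snd[of "axis i t" \<one> k d j] elim C0 k by (simp add: left_partial_def origin_def)
  qed
  ultimately show ?thesis by (auto intro: DERIV_eventually_eq)
qed

text \<open>
  The order of differentiation is opposite to the one in \<open>mixed\<close>; here the symmetry of second
  derivatives enters, and it exchanges the two direction indices in comparison with left translation.
\<close>

lemma right_partial_axis_deriv:
  assumes d: "d \<in> charts_at M \<one>" and j: "j < n" and i: "i < n" and k: "k < n"
  shows "((\<lambda>t. right_partial d j k (axis i t)) has_real_derivative mixed d j k i) (at (origin i))"
proof -
  let ?W = "local_dom (prod_chart n c0 c0) d (\<lambda>(x, y). x \<otimes> y)"
  let ?g = "partial k (mult_expr d j)"
  have W: "coord_nhd (n + n) (pair_coord \<one> \<one>) ?W"
    using mult_expr_domain[of \<one> \<one> d] C0 d by simp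
  have C2: "Ck_on (n + n) ?W (Suc (Suc 0)) (mult_expr d j)"
    by (rule mult_expr_Ck[OF smooth_manifold_chart(1)[OF M d] j])
  then have "Ck_on (n + n) ?W (Suc 0) ?g" using k by simp
  then have "((\<lambda>t. ?g ((pair_coord \<one> \<one>)(n + i := t))) has_real_derivative
      partial (n + i) ?g (pair_coord \<one> \<one>)) (at (pair_coord \<one> \<one> (n + i)))"
    using coord_nhd_imp_mem[OF W] i by (intro Ck_on_has_partial[of "n + n" _ 0]) auto
  moreover have "partial (n + i) ?g (pair_coord \<one> \<one>) = mixed d j k i"
    unfolding mixed_def by (rule partial_commute[OF C2 W]) (use i k in auto)
  moreover have "pair_coord \<one> \<one> (n + i) = origin i" using i by (simp add: pair_coord_apply origin_def)
  moreover have "eventually (\<lambda>t. ?g ((pair_coord \<one> \<one>)(n + i := t)) = right_partial d j k (axis i t)) (nhds (origin i))"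
    using axis_eventually[OF i C0(4) C0(2)]
  proof eventually_elim
    case (elim t)
    have "(pair_coord \<one> \<one>)(n + i := t) = pair_coord \<one> (axis i t)"
      using elim i by (intro ext) (auto simp: pair_coord_apply origin_def)
    then show ?case
      using partial_mult_expr_fst[of \<one> "axis i t" k d j] elim C0 k by (simp add: right_partial_def origin_def)
  qed
  ultimately show ?thesis by (auto intro: DERIV_eventually_eq)
qed

lemma dir_deriv_one: "dir_deriv M \<one> v f = (\<Sum>i<n. partial i (\<lambda>a. f (par a)) origin * v c0 i)"
  by (simp add: dir_deriv_def Let_def c0_def[symmetric] par_def origin_def)

lemma lie_bracket_coord:
  assumes d: "d \<in> charts_at M \<one>" and j: "j < n"
  shows "lie_bracket K X Y d j = (\<Sum>i<n. \<Sum>k<n. mixed d j i k * (X c0 i * Y c0 k - Y c0 i * X c0 k))"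
proof -
  have "dir_deriv M \<one> X (\<lambda>x. dir_deriv M \<one> Y (\<lambda>y. snd d (x \<otimes> y) j)) =
      (\<Sum>i<n. \<Sum>k<n. mixed d j i k * (X c0 i * Y c0 k))" for X Y
  proof -
    have "partial i (\<lambda>a. \<Sum>k<n. left_partial d j k (par a) * Y c0 k) origin = (\<Sum>k<n. mixed d j i k * Y c0 k)"
      if i: "i < n" for i
      unfolding partial_def axis_eq[symmetric]
      by (intro DERIV_imp_deriv DERIV_sum DERIV_cmult_right left_partial_axis_deriv) (use d i j in auto)
    then show ?thesis
      unfolding dir_deriv_one left_partial_def[symmetric] by (simp add: sum_distrib_left mult_ac)
  qed
  then show ?thesis
    using d j by (simp add: lie_bracket_def Let_def right_diff_distrib sum_subtractf)
qed

lemma Ad_coord_relation: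
  assumes d: "d \<in> charts_at M \<one>" "d \<in> charts_at M x" and j: "j < n" and v: "v \<in> lie_algebra K"
  shows "(\<Sum>l<n. right_partial d j l x * Ad K x v c0 l) = (\<Sum>k<n. left_partial d j k x * v c0 k)"
proof -
  have x: "x \<in> carrier K" using smooth_manifold_chart(3)[OF M d(2)] by simp
  have "differential M M \<one> (\<lambda>y. y \<otimes> x) (Ad K x v) d j = differential M M \<one> (\<lambda>y. x \<otimes> y) v d j"
    using right_differential_Ad[OF x v] by simp
  then show ?thesis
    using d j x by (simp add: differential_def dir_deriv_one right_partial_def left_partial_def)
qed

lemma right_partial_one:
  assumes d: "d \<in> charts_at M \<one>" and j: "j < n" and l: "l < n"
  shows "right_partial d j l \<one> = basis l d j"
proof -
  have "right_partial d j l \<one> = deriv (\<lambda>t. snd d (axis l t) j) (origin l)"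
    unfolding right_partial_def partial_def axis_eq[symmetric]
  proof (rule deriv_cong_ev[OF _ refl])
    show "\<forall>\<^sub>F t in nhds (origin l). snd d (axis l t \<otimes> \<one>) j = snd d (axis l t) j"
      using axis_eventually[OF l C0(4) C0(2)]
      by eventually_elim (use c0_subset in \<open>simp add: subset_iff\<close>)
  qed
  then show ?thesis using d j by (simp add: basis_def coord_vector_def axis_def origin_def)
qed

lemma axis_has_velocity: "i < n \<Longrightarrow> has_velocity M (axis i) (origin i) (basis i)"
  using coord_curve_has_velocity[OF M c0] by (simp add: axis_def basis_def origin_def)

lemma basis_c0: "i < n \<Longrightarrow> basis i c0 k = (if k = i then 1 else 0)"
  using coord_vector_chart[OF M c0] by (simp add: basis_def)

lemma basis_in: "i < n \<Longrightarrow> basis i \<in> lie_algebra K"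
  using coord_vector_in_tangent_space[OF M c0] by (simp add: basis_def lie_algebra_def)

lemma lie_algebra_expand: "v \<in> lie_algebra K \<Longrightarrow> v = (\<Sum>i<n. v c0 i *\<^sub>t basis i)"
  unfolding basis_def lie_algebra_def by (rule tangent_expand_sum[OF M c0])

lemma subspace_lie_algebra: "tangent.subspace (lie_algebra K)"
  unfolding lie_algebra_def by (rule subspace_tangent_space)

text \<open>
  Written as right translation by \<open>inv x\<close> after left translation by \<open>x\<close>, the matrix of \<open>Ad\<^sub>x\<close> is a
  product of first partial derivatives of the multiplication, evaluated at \<open>(x, inv x)\<close> and at
  \<open>(x, 1)\<close>. These are \<open>C\<^sup>1\<close> functions along differentiable curves.
\<close>

lemma Ad_axis_differentiable:
  assumes v: "v \<in> lie_algebra K" and i: "i < n" and l: "l < n"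
  shows "\<exists>D. ((\<lambda>t. Ad K (axis i t) v c0 l) has_real_derivative D) (at (origin i))"
proof -
  let ?W = "local_dom (prod_chart n c0 c0) c0 (\<lambda>(x, y). x \<otimes> y)"
  let ?g = "\<lambda>m t. partial m (mult_expr c0 l) (pair_coord (axis i t) (inv (axis i t)))"
  have inv: "curve_differentiable M M (\<lambda>x. inv x)"
    by (rule smooth_map_imp_curve_differentiable[OF M M inv_smooth])
  define V where "V = {x \<in> topspace (mtop M). inv x \<in> fst c0}"
  have V: "openin (mtop M) V" "\<one> \<in> V"
    unfolding V_def using inv_smooth C0 by (auto simp: smooth_map_def intro!: openin_continuous_map_preimage simp del: top)
  note ev = axis_eventually[OF i V]
  have "\<exists>D. (?g m has_real_derivative D) (at (origin i))" if m: "m < n" for m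
  proof -
    define w where "w = differential M M \<one> (\<lambda>x. inv x) (basis i)"
    have w: "has_velocity M (\<lambda>t. inv (axis i t)) (origin i) w"
      using curve_differentiableD[OF inv axis_has_velocity[OF i]] by (simp add: axis_origin w_def)
    have "((\<lambda>t. partial m (mult_expr c0 l) (pair_coord (axis i t) (inv (axis i t)))) has_real_derivative
       (\<Sum>r<n + n. partial r (partial m (mult_expr c0 l)) (pair_coord (axis i (origin i)) (inv (axis i (origin i))))
         * (if r < n then basis i c0 r else w c0 (r - n)))) (at (origin i))"
    proof (rule chain_rule_curve)
      show "Ck_on (n + n) ?W (Suc 0) (partial m (mult_expr c0 l))"
        using mult_expr_Ck[OF C0(1) l, of "Suc (Suc 0)"] m by simp
      show "coord_nhd (n + n) (pair_coord (axis i (origin i)) (inv (axis i (origin i)))) ?W"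
        using mult_expr_domain[of \<one> \<one> c0] C0 c0 by (simp add: axis_origin)
      show "((\<lambda>t. pair_coord (axis i t) (inv (axis i t)) r) has_real_derivative
          (if r < n then basis i c0 r else w c0 (r - n))) (at (origin i))" if "r < n + n" for r
        using that has_velocity_deriv[OF axis_has_velocity[OF i], of c0 r]
          has_velocity_deriv[OF w, of c0 "r - n"] c0
        by (auto simp: pair_coord_apply axis_origin)
      show "\<forall>\<^sub>F t in nhds (origin i). \<forall>r\<ge>n + n. pair_coord (axis i t) (inv (axis i t)) r = 0"
        using ev by eventually_elim (auto simp: pair_coord_apply V_def intro!: chart_zero_beyond_dim[OF C0(5)])
    qed
    then show ?thesis by blast
  qed
  then obtain D where D: "\<And>m. m < n \<Longrightarrow> (?g m has_real_derivative D m) (at (origin i))" by metis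
  have "((\<lambda>t. \<Sum>m<n. (\<Sum>k<n. left_partial c0 m k (axis i t) * v c0 k) * ?g m t) has_real_derivative
      (\<Sum>m<n. (\<Sum>k<n. mixed c0 m i k * v c0 k) * ?g m (origin i) +
        D m * (\<Sum>k<n. left_partial c0 m k (axis i (origin i)) * v c0 k))) (at (origin i))"
    by (intro DERIV_sum DERIV_mult DERIV_cmult_right left_partial_axis_deriv) (use D i c0 in auto)
  moreover have "\<forall>\<^sub>F t in nhds (origin i).
      (\<Sum>m<n. (\<Sum>k<n. left_partial c0 m k (axis i t) * v c0 k) * ?g m t) = Ad K (axis i t) v c0 l"
    using ev
  proof eventually_elim
    case (elim t)
    define x where "x = axis i t"
    have x: "x \<in> fst c0" "inv x \<in> fst c0" "x \<in> carrier K" using elim by (auto simp: V_def x_def)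
    have cx: "c0 \<in> charts_at M x" using x C0 by (simp add: charts_at_def)
    have L: "differential M M \<one> (\<lambda>y. x \<otimes> y) v \<in> tangent_space M x"
      using differential_in_tangent_space[OF M M left_mult_curve_differentiable[OF x(3)] one_in_top] v x
      by (simp add: lie_algebra_def)
    have "Ad K x v c0 l = (\<Sum>m<n. differential M M \<one> (\<lambda>y. x \<otimes> y) v c0 m *
        partial m (\<lambda>a. snd c0 (inv_into (fst c0) (snd c0) a \<otimes> inv x) l) (snd c0 x))"
      unfolding Ad_eq_right_left[OF x(3) v]
      by (rule differential_in_chart[OF M right_mult_curve_differentiable cx _ l L])
        (use x c0 in auto)
    moreover have "differential M M \<one> (\<lambda>y. x \<otimes> y) v c0 m = (\<Sum>k<n. left_partial c0 m k x * v c0 k)"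
      if "m < n" for m
      using that x cx by (simp add: differential_def dir_deriv_one left_partial_def)
    ultimately show ?case
      using x by (simp add: x_def[symmetric] partial_mult_expr_fst par_def)
  qed
  ultimately show ?thesis by (blast intro: DERIV_eventually_eq)
qed

lemma lie_bracket_basis_coord:
  assumes d: "d \<in> charts_at M \<one>" and j: "j < n" and i: "i < n"
  shows "lie_bracket K (basis i) v d j =
    (\<Sum>k<n. mixed d j i k * v c0 k) - (\<Sum>k<n. mixed d j k i * v c0 k)"
proof -
  have B: "basis i c0 k = of_bool (k = i)" for k
    using basis_c0[OF i] by simp
  have 1: "(\<Sum>r<n. \<Sum>k<n. mixed d j r k * (of_bool (r = i) * v c0 k)) = (\<Sum>k<n. mixed d j i k * v c0 k)"
    using i by (subst sum.swap) (simp add: mult.left_commute[of _ "of_bool _"] sum.delta)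
  have 2: "(\<Sum>r<n. \<Sum>k<n. mixed d j r k * (v c0 r * of_bool (k = i))) = (\<Sum>r<n. mixed d j r i * v c0 r)"
    using i by (simp add: mult.assoc[symmetric] sum.delta)
  show ?thesis
    unfolding lie_bracket_coord[OF d j] B right_diff_distrib sum_subtractf 1 2 ..
qed

text \<open>
  Differentiate \<open>dR\<^sub>x (Ad\<^sub>x v) = dL\<^sub>x v\<close> along the \<open>i\<close>-th coordinate line at the identity. There \<open>dR\<close> is
  the transition matrix from the chart \<open>c0\<close> to \<open>d\<close> and \<open>Ad\<close> is the identity, so the derivative of \<open>Ad\<close>
  transformed to \<open>d\<close> is the difference of the derivatives of \<open>dL\<close> and \<open>dR\<close>, which is the bracket. Working with an arbitrary
  chart \<open>d\<close> shows at the same time that the bracket transforms like a tangent vector.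
\<close>

lemma bracket_basis_is_Ad_derivative:
  assumes v: "v \<in> lie_algebra K" and i: "i < n"
  shows "\<exists>D. (\<forall>l<n. ((\<lambda>t. Ad K (axis i t) v c0 l) has_real_derivative D l) (at (origin i))) \<and>
    lie_bracket K (basis i) v = (\<Sum>l<n. D l *\<^sub>t basis l)"
proof -
  obtain D where D: "\<And>l. l < n \<Longrightarrow> ((\<lambda>t. Ad K (axis i t) v c0 l) has_real_derivative D l) (at (origin i))"
    using Ad_axis_differentiable[OF v i] by metis
  have "lie_bracket K (basis i) v d j = (\<Sum>l<n. D l * basis l d j)" for d j
  proof (cases "d \<in> charts_at M \<one> \<and> j < n")
    case True
    then have d: "d \<in> charts_at M \<one>" and j: "j < n" by auto
    note Dd = smooth_manifold_chart[OF M d]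
    have "((\<lambda>t. \<Sum>l<n. right_partial d j l (axis i t) * Ad K (axis i t) v c0 l) has_real_derivative
        (\<Sum>l<n. mixed d j l i * Ad K (axis i (origin i)) v c0 l + D l * right_partial d j l (axis i (origin i))))
        (at (origin i))"
      by (intro DERIV_sum DERIV_mult right_partial_axis_deriv) (use D i j d in auto)
    moreover have L: "((\<lambda>t. \<Sum>k<n. left_partial d j k (axis i t) * v c0 k) has_real_derivative
        (\<Sum>k<n. mixed d j i k * v c0 k)) (at (origin i))"
      by (intro DERIV_sum DERIV_cmult_right left_partial_axis_deriv) (use i j d in auto)
    moreover have "\<forall>\<^sub>F t in nhds (origin i). (\<Sum>l<n. right_partial d j l (axis i t) * Ad K (axis i t) v c0 l) =
        (\<Sum>k<n. left_partial d j k (axis i t) * v c0 k)"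
      using axis_eventually[OF i Dd(4) Dd(2)]
      by eventually_elim (use d j v in \<open>auto intro!: Ad_coord_relation simp: charts_at_def\<close>)
    ultimately have "(\<Sum>l<n. mixed d j l i * Ad K \<one> v c0 l + D l * right_partial d j l \<one>) =
        (\<Sum>k<n. mixed d j i k * v c0 k)"
      unfolding axis_origin by (intro DERIV_unique[OF DERIV_eventually_eq L])
    then have "(\<Sum>l<n. mixed d j l i * v c0 l) + (\<Sum>l<n. D l * basis l d j) = (\<Sum>k<n. mixed d j i k * v c0 k)"
      using d j by (simp add: Ad_one[OF v] right_partial_one sum.distrib)
    moreover have "lie_bracket K (basis i) v d j =
        (\<Sum>k<n. mixed d j i k * v c0 k) - (\<Sum>l<n. mixed d j l i * v c0 l)"
      by (rule lie_bracket_basis_coord[OF d j i])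
    ultimately show ?thesis by simp
  next
    case False
    then show ?thesis by (auto simp: lie_bracket_def Let_def basis_def coord_vector_def)
  qed
  then have "lie_bracket K (basis i) v = (\<Sum>l<n. D l *\<^sub>t basis l)"
    by (intro ext) (simp add: sum_tangent_apply tscale_def)
  with D show ?thesis by blast
qed

lemma lie_bracket_expand:
  "lie_bracket K X Y = (\<Sum>i<n. X c0 i *\<^sub>t lie_bracket K (basis i) Y)"
proof (intro ext)
  fix d j
  show "lie_bracket K X Y d j = (\<Sum>i<n. X c0 i *\<^sub>t lie_bracket K (basis i) Y) d j"
  proof (cases "d \<in> charts_at M \<one> \<and> j < n")
    case True
    then have d: "d \<in> charts_at M \<one>" and j: "j < n" by auto
    have B: "lie_bracket K X Y d j = (\<Sum>k<n. \<Sum>l<n. mixed d j k l * X c0 k * Y c0 l) -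
        (\<Sum>k<n. \<Sum>l<n. mixed d j k l * Y c0 k * X c0 l)" for X
      unfolding lie_bracket_coord[OF d j] by (simp add: right_diff_distrib sum_subtractf mult.assoc)
    have "lie_bracket K (basis i) Y d j = (\<Sum>l<n. mixed d j i l * Y c0 l) - (\<Sum>k<n. mixed d j k i * Y c0 k)"
      if "i < n" for i
      by (rule lie_bracket_basis_coord[OF d j that])
    then have "(\<Sum>i<n. X c0 i *\<^sub>t lie_bracket K (basis i) Y) d j =
        (\<Sum>i<n. X c0 i * ((\<Sum>l<n. mixed d j i l * Y c0 l) - (\<Sum>k<n. mixed d j k i * Y c0 k)))"
      by (simp add: sum_tangent_apply tscale_def)
    also have "\<dots> = (\<Sum>i<n. (\<Sum>l<n. mixed d j i l * X c0 i * Y c0 l) - (\<Sum>k<n. mixed d j k i * Y c0 k * X c0 i))"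
      unfolding right_diff_distrib sum_distrib_left by (simp only: mult_ac)
    also have "\<dots> = (\<Sum>i<n. \<Sum>l<n. mixed d j i l * X c0 i * Y c0 l) -
        (\<Sum>i<n. \<Sum>k<n. mixed d j k i * Y c0 k * X c0 i)"
      by (rule sum_subtractf)
    also have "(\<Sum>i<n. \<Sum>k<n. mixed d j k i * Y c0 k * X c0 i) = (\<Sum>k<n. \<Sum>l<n. mixed d j k l * Y c0 k * X c0 l)"
      by (rule sum.swap)
    finally show ?thesis using B[of X] by simp
  next
    case False
    then have "lie_bracket K X Y d j = 0" for X by (auto simp: lie_bracket_def Let_def)
    then show ?thesis by (simp add: sum_tangent_apply tscale_def)
  qed
qed

lemma lie_bracket_antisym: "lie_bracket K Y X = - lie_bracket K X Y"
  by (intro ext) (simp add: lie_bracket_def Let_def)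

lemma lie_bracket_in: 
  assumes Y: "Y \<in> lie_algebra K"
  shows "lie_bracket K X Y \<in> lie_algebra K"
proof -
  have "lie_bracket K (basis i) Y \<in> lie_algebra K" if i: "i < n" for i
  proof -
    obtain D where "lie_bracket K (basis i) Y = (\<Sum>l<n. D l *\<^sub>t basis l)"
      using bracket_basis_is_Ad_derivative[OF Y i] by blast
    then show ?thesis
      by (auto intro!: tangent.subspace_sum tangent.subspace_scale subspace_lie_algebra basis_in)
  qed
  then show ?thesis
    unfolding lie_bracket_expand[of X Y]
    by (auto intro!: tangent.subspace_sum tangent.subspace_scale subspace_lie_algebra)
qed

end


section \<open>Bilinear forms\<close>

definition bilinear_on :: "'a tangent set \<Rightarrow> ('a tangent \<Rightarrow> 'a tangent \<Rightarrow> real) \<Rightarrow> bool" where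
  "bilinear_on V c \<longleftrightarrow>
     (\<forall>u\<in>V. \<forall>v\<in>V. \<forall>w\<in>V. c (u + v) w = c u w + c v w \<and> c w (u + v) = c w u + c w v) \<and>
     (\<forall>r. \<forall>u\<in>V. \<forall>w\<in>V. c (r *\<^sub>t u) w = r * c u w \<and> c w (r *\<^sub>t u) = r * c w u)"

lemma bilinear_on_add:
  assumes "bilinear_on V c" "u \<in> V" "v \<in> V" "w \<in> V"
  shows "c (u + v) w = c u w + c v w" "c w (u + v) = c w u + c w v"
  using assms by (simp_all add: bilinear_on_def)

lemma bilinear_on_scale:
  assumes "bilinear_on V c" "u \<in> V" "w \<in> V"
  shows "c (r *\<^sub>t u) w = r * c u w" "c w (r *\<^sub>t u) = r * c w u"
  using assms by (simp_all add: bilinear_on_def)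

lemma tscale_zero [simp]: "0 *\<^sub>t v = 0" "r *\<^sub>t 0 = 0" "1 *\<^sub>t v = v"
  by (auto simp: tscale_def fun_eq_iff)

lemma bilinear_on_zero:
  assumes "bilinear_on V c" "w \<in> V"
  shows "c 0 w = 0" "c w 0 = 0"
  using bilinear_on_scale[OF assms assms(2), of 0]
  by auto

lemma bilinear_on_minus:
  assumes "bilinear_on V c" "u \<in> V" "w \<in> V"
  shows "c (- u) w = - c u w"
proof -
  have "- u = (-1) *\<^sub>t u" by (auto simp: tscale_def fun_eq_iff)
  then show ?thesis using bilinear_on_scale(1)[OF assms, of "-1"] by simp
qed

lemma bilinear_on_sum:
  assumes c: "bilinear_on V c" and V: "tangent.subspace V" and w: "w \<in> V"
    and e: "\<And>i. i \<in> I \<Longrightarrow> e i \<in> V"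
  shows "c (\<Sum>i\<in>I. a i *\<^sub>t e i) w = (\<Sum>i\<in>I. a i * c (e i) w)"
    and "c w (\<Sum>i\<in>I. a i *\<^sub>t e i) = (\<Sum>i\<in>I. a i * c w (e i))"
proof -
  have "c (\<Sum>i\<in>I. a i *\<^sub>t e i) w = (\<Sum>i\<in>I. a i * c (e i) w) \<and>
      c w (\<Sum>i\<in>I. a i *\<^sub>t e i) = (\<Sum>i\<in>I. a i * c w (e i))"
    using e
  proof (induction I rule: infinite_finite_induct)
    case (insert i I)
    have S: "a i *\<^sub>t e i \<in> V" "(\<Sum>i\<in>I. a i *\<^sub>t e i) \<in> V" and i: "e i \<in> V"
      using insert.prems V by (auto intro: tangent.subspace_sum tangent.subspace_scale)
    then show ?case
      unfolding sum.insert[OF insert.hyps] bilinear_on_add[OF c S w] bilinear_on_scale[OF c i w]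
      using insert by simp
  qed (use bilinear_on_zero[OF c w] in auto)
  then show "c (\<Sum>i\<in>I. a i *\<^sub>t e i) w = (\<Sum>i\<in>I. a i * c (e i) w)"
    and "c w (\<Sum>i\<in>I. a i *\<^sub>t e i) = (\<Sum>i\<in>I. a i * c w (e i))" by auto
qed

lemma inner_product_on_imp_bilinear_on:
  assumes V: "tangent.subspace V" and B: "inner_product_on V B"
  shows "bilinear_on V B"
  unfolding bilinear_on_def
proof (intro conjI ballI allI)
  have sym: "\<And>u v. u \<in> V \<Longrightarrow> v \<in> V \<Longrightarrow> B u v = B v u"
    and add: "\<And>u v w. u \<in> V \<Longrightarrow> v \<in> V \<Longrightarrow> w \<in> V \<Longrightarrow> B (u + v) w = B u w + B v w"
    and scale: "\<And>r u w. u \<in> V \<Longrightarrow> w \<in> V \<Longrightarrow> B (r *\<^sub>t u) w = r * B u w"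
    using B by (simp_all add: inner_product_on_def)
  fix u v w r assume u: "u \<in> V" and w: "w \<in> V"
  show "B (r *\<^sub>t u) w = r * B u w" by (rule scale[OF u w])
  then show "B w (r *\<^sub>t u) = r * B w u"
    using sym[OF tangent.subspace_scale[OF V u] w] sym[OF u w] by simp
  assume v: "v \<in> V"
  show "B (u + v) w = B u w + B v w" by (rule add[OF u v w])
  then show "B w (u + v) = B w u + B w v"
    using sym[OF tangent.subspace_add[OF V u v] w] sym[OF u w] sym[OF v w] by simp
qed

text \<open>
  A minimum of a quadratic form is a critical point: if \<open>q (x, z)\<close> were nonzero, then \<open>q\<close> would be
  negative at \<open>x + t z\<close> for some small \<open>t\<close>.
\<close>

lemma positive_semidefinite_kernel:
  assumes q: "bilinear_on V q" and V: "tangent.subspace V"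
    and sym: "\<And>u v. u \<in> V \<Longrightarrow> v \<in> V \<Longrightarrow> q u v = q v u"
    and pos: "\<And>u. u \<in> V \<Longrightarrow> q u u \<ge> 0"
    and x: "x \<in> V" "q x x = 0" and z: "z \<in> V"
  shows "q x z = 0"
proof -
  define a b where "a = q z z" and "b = q x z"
  have a: "a \<ge> 0" unfolding a_def by (rule pos[OF z])
  have quad: "2 * t * b + t\<^sup>2 * a \<ge> 0" for t
  proof -
    have tz: "t *\<^sub>t z \<in> V" and s: "x + t *\<^sub>t z \<in> V"
      using V x z by (auto intro: tangent.subspace_add tangent.subspace_scale)
    have "q (x + t *\<^sub>t z) (x + t *\<^sub>t z) = 2 * t * b + t\<^sup>2 * a"
      using x z sym[OF x(1) z]
      by (simp add: bilinear_on_add(1)[OF q x(1) tz s] bilinear_on_add(2)[OF q x(1) tz] tz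
          bilinear_on_scale[OF q z] a_def b_def power2_eq_square algebra_simps)
    then show ?thesis using pos[OF s] by simp
  qed
  \<comment> \<open>The quadratic polynomial is negative at \<open>t = - b / (a + 1)\<close> unless \<open>b = 0\<close>.\<close>
  have "2 * (- b / (a + 1)) * b + (- b / (a + 1))\<^sup>2 * a = - (b\<^sup>2 * (a + 2)) / (a + 1)\<^sup>2"
    using a by (simp add: divide_simps power2_eq_square) (simp add: algebra_simps)
  with quad[of "- b / (a + 1)"] have "0 \<le> - (b\<^sup>2 * (a + 2)) / (a + 1)\<^sup>2" by simp
  then have "b\<^sup>2 * (a + 2) / (a + 1)\<^sup>2 \<le> 0" by simp
  moreover have "(a + 1)\<^sup>2 > 0" using a by simp
  ultimately have "b\<^sup>2 * (a + 2) \<le> 0" unfolding divide_le_0_iff by linarith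
  then have "b\<^sup>2 \<le> 0" using a by (simp add: mult_le_0_iff)
  then show ?thesis by (simp add: b_def)
qed

text \<open>
  The unit sphere of \<open>R^n\<close> for the maximum norm, which suits the product topology: it is a closed
  subset of a product of compact intervals.
\<close>

lemma compact_max_norm_sphere:
  "compact {y :: nat \<Rightarrow> real. (\<forall>i. \<bar>y i\<bar> \<le> 1) \<and> (\<forall>i\<ge>n. y i = 0) \<and> (\<exists>i<n. \<bar>y i\<bar> = 1)}"
proof -
  let ?B = "PiE (UNIV :: nat set) (\<lambda>i. if i < n then {- 1..1} else {0 :: real})"
  have "compactin (product_topology (\<lambda>i. euclideanreal) UNIV) ?B"
    by (auto simp: compactin_PiE)
  then have "compact ?B" by (simp add: euclidean_product_topology)
  moreover have "closed {y :: nat \<Rightarrow> real. \<bar>y i\<bar> = 1}" for i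
    by (rule closed_Collect_eq) (auto intro: continuous_on_rabs continuous_on_product_coordinates)
  then have "closed (\<Union>i\<in>{..<n}. {y :: nat \<Rightarrow> real. \<bar>y i\<bar> = 1})"
    by (intro closed_UN) auto
  ultimately have "compact (?B \<inter> (\<Union>i\<in>{..<n}. {y. \<bar>y i\<bar> = 1}))"
    by (rule compact_Int_closed)
  moreover have "?B \<inter> (\<Union>i\<in>{..<n}. {y. \<bar>y i\<bar> = 1}) =
      {y. (\<forall>i. \<bar>y i\<bar> \<le> 1) \<and> (\<forall>i\<ge>n. y i = 0) \<and> (\<exists>i<n. \<bar>y i\<bar> = 1)}"
    by (auto simp: PiE_iff abs_le_iff split: if_splits) (metis abs_le_iff abs_zero not_less zero_le_one minus_le_iff)+
  ultimately show ?thesis by simp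
qed

section \<open>Invariant forms\<close>

context lie
begin

definition invariant_form :: "('a tangent \<Rightarrow> 'a tangent \<Rightarrow> real) \<Rightarrow> bool" where
  "invariant_form c \<longleftrightarrow> bilinear_on (lie_algebra K) c \<and>
     (\<forall>x\<in>carrier K. \<forall>X\<in>lie_algebra K. \<forall>Y\<in>lie_algebra K. c (Ad K x X) (Ad K x Y) = c X Y)"

lemma invariant_form_bilinear: "invariant_form c \<Longrightarrow> bilinear_on (lie_algebra K) c"
  by (simp add: invariant_form_def)

lemma bilinear_coord:
  assumes c: "bilinear_on (lie_algebra K) c" and X: "X \<in> lie_algebra K" and Y: "Y \<in> lie_algebra K"
  shows "c X Y = (\<Sum>l<n. \<Sum>m<n. X c0 l * Y c0 m * c (basis l) (basis m))"
proof -
  have "c X Y = (\<Sum>l<n. X c0 l * c (basis l) Y)"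
    using bilinear_on_sum(1)[OF c subspace_lie_algebra Y, of "{..<n}" basis "X c0"]
      lie_algebra_expand[OF X] basis_in by auto
  also have "\<dots> = (\<Sum>l<n. X c0 l * (\<Sum>m<n. Y c0 m * c (basis l) (basis m)))"
    using bilinear_on_sum(2)[OF c subspace_lie_algebra basis_in, of _ "{..<n}" basis "Y c0"]
      lie_algebra_expand[OF Y] basis_in by auto
  finally show ?thesis by (simp add: sum_distrib_left mult.assoc)
qed

lemma basis_combination:
  "(\<Sum>i<n. y i *\<^sub>t basis i) \<in> lie_algebra K"
  "k < n \<Longrightarrow> (\<Sum>i<n. y i *\<^sub>t basis i) c0 k = y k"
  by (auto intro!: tangent.subspace_sum tangent.subspace_scale subspace_lie_algebra basis_in)
    (simp add: sum_tangent_apply tscale_def basis_c0 if_distrib sum.delta cong: if_cong)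

text \<open>
  In coordinates \<open>c (Ad\<^sub>x Y, Ad\<^sub>x Z) = c (Y, Z)\<close> is a polynomial identity in the entries of \<open>Ad\<^sub>x\<close>;
  its derivative along a coordinate line is computed by the product rule.
\<close>

lemma infinitesimal_invariance_basis:
  assumes c: "invariant_form c" and i: "i < n" and Y: "Y \<in> lie_algebra K" and Z: "Z \<in> lie_algebra K"
  shows "c (lie_bracket K (basis i) Y) Z = - c Y (lie_bracket K (basis i) Z)"
proof -
  note bil = invariant_form_bilinear[OF c]
  let ?b = "\<lambda>l m. c (basis l) (basis m)"
  obtain D where D: "\<And>l. l < n \<Longrightarrow> ((\<lambda>t. Ad K (axis i t) Y c0 l) has_real_derivative D l) (at (origin i))"
    and BY: "lie_bracket K (basis i) Y = (\<Sum>l<n. D l *\<^sub>t basis l)"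
    using bracket_basis_is_Ad_derivative[OF Y i] by blast
  obtain D' where D': "\<And>l. l < n \<Longrightarrow> ((\<lambda>t. Ad K (axis i t) Z c0 l) has_real_derivative D' l) (at (origin i))"
    and BZ: "lie_bracket K (basis i) Z = (\<Sum>l<n. D' l *\<^sub>t basis l)"
    using bracket_basis_is_Ad_derivative[OF Z i] by blast
  have "((\<lambda>t. \<Sum>l<n. \<Sum>m<n. Ad K (axis i t) Y c0 l * Ad K (axis i t) Z c0 m * ?b l m) has_real_derivative
      (\<Sum>l<n. \<Sum>m<n. (D l * Ad K (axis i (origin i)) Z c0 m + D' m * Ad K (axis i (origin i)) Y c0 l) * ?b l m))
      (at (origin i))"
    by (intro DERIV_sum DERIV_cmult_right DERIV_mult) (use D D' in auto)
  moreover have "\<forall>\<^sub>F t in nhds (origin i).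
      (\<Sum>l<n. \<Sum>m<n. Ad K (axis i t) Y c0 l * Ad K (axis i t) Z c0 m * ?b l m) = c Y Z"
    using axis_eventually[OF i C0(4) C0(2)]
  proof eventually_elim
    case (elim t)
    then have x: "axis i t \<in> carrier K" using c0_subset by auto
    have "c (Ad K (axis i t) Y) (Ad K (axis i t) Z) = c Y Z"
      using c x Y Z by (simp add: invariant_form_def)
    then show ?case
      using bilinear_coord[OF bil Ad_in_lie_algebra[OF x Y] Ad_in_lie_algebra[OF x Z]] by simp
  qed
  ultimately have "((\<lambda>t. c Y Z) has_real_derivative
      (\<Sum>l<n. \<Sum>m<n. (D l * Ad K (axis i (origin i)) Z c0 m + D' m * Ad K (axis i (origin i)) Y c0 l) * ?b l m))
      (at (origin i))"
    by (rule DERIV_eventually_eq)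
  then have "(\<Sum>l<n. \<Sum>m<n. (D l * Z c0 m + D' m * Y c0 l) * ?b l m) = 0"
    unfolding axis_origin Ad_one[OF Y] Ad_one[OF Z] using DERIV_unique DERIV_const by blast
  then have "(\<Sum>l<n. \<Sum>m<n. D l * Z c0 m * ?b l m) + (\<Sum>l<n. \<Sum>m<n. Y c0 l * D' m * ?b l m) = 0"
    by (simp add: distrib_right sum.distrib mult.commute[of "D' _"])
  moreover have "c (lie_bracket K (basis i) Y) Z = (\<Sum>l<n. \<Sum>m<n. D l * Z c0 m * ?b l m)"
    unfolding BY by (subst bilinear_coord[OF bil basis_combination(1) Z]) (simp add: basis_combination(2))
  moreover have "c Y (lie_bracket K (basis i) Z) = (\<Sum>l<n. \<Sum>m<n. Y c0 l * D' m * ?b l m)"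
    unfolding BZ by (subst bilinear_coord[OF bil Y basis_combination(1)]) (simp add: basis_combination(2))
  ultimately show ?thesis by simp
qed

lemma infinitesimal_invariance:
  assumes c: "invariant_form c" and Y: "Y \<in> lie_algebra K" and Z: "Z \<in> lie_algebra K"
  shows "c (lie_bracket K X Y) Z = - c Y (lie_bracket K X Z)"
proof -
  note bil = invariant_form_bilinear[OF c]
  have "c (lie_bracket K X Y) Z = (\<Sum>i<n. X c0 i * c (lie_bracket K (basis i) Y) Z)"
    unfolding lie_bracket_expand[of X Y]
    by (rule bilinear_on_sum(1)[OF bil subspace_lie_algebra Z lie_bracket_in[OF Y]])
  also have "\<dots> = - (\<Sum>i<n. X c0 i * c Y (lie_bracket K (basis i) Z))"
    by (simp add: infinitesimal_invariance_basis[OF c _ Y Z] sum_negf)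
  also have "(\<Sum>i<n. X c0 i * c Y (lie_bracket K (basis i) Z)) = c Y (lie_bracket K X Z)"
    unfolding lie_bracket_expand[of X Z]
    by (rule bilinear_on_sum(2)[OF bil subspace_lie_algebra Y lie_bracket_in[OF Z], symmetric])
  finally show ?thesis .
qed

lemma radical_is_ideal:
  assumes c: "invariant_form c"
  shows "lie_ideal K {Y \<in> lie_algebra K. \<forall>Z\<in>lie_algebra K. c Y Z = 0}"
proof -
  note bil = invariant_form_bilinear[OF c]
  have "tangent.subspace {Y \<in> lie_algebra K. \<forall>Z\<in>lie_algebra K. c Y Z = 0}"
    using tangent.subspace_0[OF subspace_lie_algebra] tangent.subspace_add[OF subspace_lie_algebra]
      tangent.subspace_scale[OF subspace_lie_algebra]
    by (intro tangent.subspaceI)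
      (simp_all add: bilinear_on_zero(1)[OF bil] bilinear_on_add(1)[OF bil] bilinear_on_scale(1)[OF bil])
  then show ?thesis
    using infinitesimal_invariance[OF c] lie_bracket_in by (auto simp: lie_ideal_def)
qed

text \<open>
  The trilinear form \<open>c ([X, Y], Z)\<close> changes sign under the transposition of \<open>X\<close> and \<open>Y\<close> but not under
  that of \<open>Y\<close> and \<open>Z\<close>. In the symmetric group both transpositions are conjugate, so it is zero.
\<close>

lemma skew_invariant_form_vanishes_on_brackets:
  assumes c: "invariant_form c"
    and skew: "\<And>X Y. X \<in> lie_algebra K \<Longrightarrow> Y \<in> lie_algebra K \<Longrightarrow> c X Y = - c Y X"
    and X: "X \<in> lie_algebra K" and Y: "Y \<in> lie_algebra K" and Z: "Z \<in> lie_algebra K"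
  shows "c (lie_bracket K X Y) Z = 0"
proof -
  have 23: "c (lie_bracket K X Y) Z = c (lie_bracket K X Z) Y"
    if "Y \<in> lie_algebra K" "Z \<in> lie_algebra K" for X Y Z
    using infinitesimal_invariance[OF c that] skew[OF that(1) lie_bracket_in[OF that(2)]] by simp
  have 12: "c (lie_bracket K X Y) Z = - c (lie_bracket K Y X) Z"
    if "X \<in> lie_algebra K" "Z \<in> lie_algebra K" for X Y Z
    using bilinear_on_minus[OF invariant_form_bilinear[OF c] lie_bracket_in[OF that(1)] that(2)]
      lie_bracket_antisym[of X Y] by metis
  have "c (lie_bracket K X Y) Z = c (lie_bracket K X Z) Y" using 23 Y Z by blast
  also have "\<dots> = - c (lie_bracket K Z X) Y" using 12 X Y by blast
  also have "\<dots> = - c (lie_bracket K Z Y) X" using 23 X Y by simp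
  also have "\<dots> = c (lie_bracket K Y Z) X" using 12[of Z X Y] X Z by simp
  also have "\<dots> = c (lie_bracket K Y X) Z" using 23 X Z by blast
  also have "\<dots> = - c (lie_bracket K X Y) Z" using 12 Y Z by blast
  finally show ?thesis by simp
qed

text \<open>
  If the radical is zero, all brackets vanish and every line is an ideal; then \<open>k\<close> is at most a line,
  which has no nonzero skew form.
\<close>

lemma skew_invariant_form_zero:
  assumes simple: "\<forall>I. lie_ideal K I \<longrightarrow> I = {0} \<or> I = lie_algebra K"
    and c: "invariant_form c"
    and skew: "\<And>X Y. X \<in> lie_algebra K \<Longrightarrow> Y \<in> lie_algebra K \<Longrightarrow> c X Y = - c Y X"
    and X: "X \<in> lie_algebra K" and Y: "Y \<in> lie_algebra K"
  shows "c X Y = 0"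
proof (cases "{Y \<in> lie_algebra K. \<forall>Z\<in>lie_algebra K. c Y Z = 0} = lie_algebra K")
  case True
  then show ?thesis using X Y by blast
next
  case False
  note bil = invariant_form_bilinear[OF c]
  have rad: "{Y \<in> lie_algebra K. \<forall>Z\<in>lie_algebra K. c Y Z = 0} = {0}"
    using simple[rule_format, OF radical_is_ideal[OF c]] False by blast
  have abelian: "lie_bracket K A B = 0" if "A \<in> lie_algebra K" "B \<in> lie_algebra K" for A B
    using rad skew_invariant_form_vanishes_on_brackets[OF c skew that] lie_bracket_in[OF that(2)] by blast
  show ?thesis
  proof (cases "X = 0")
    case True
    then show ?thesis using bilinear_on_zero[OF bil Y] by simp
  next
    case False
    have sub: "tangent.span {X} \<subseteq> lie_algebra K"
      using X by (intro tangent.span_minimal subspace_lie_algebra) auto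
    then have "lie_ideal K (tangent.span {X})"
      using abelian tangent.span_zero by (auto simp: lie_ideal_def subset_iff)
    from simple[rule_format, OF this] have "tangent.span {X} = lie_algebra K"
      using False tangent.span_base[of X "{X}"] by auto
    with Y obtain r where "Y = r *\<^sub>t X" by (auto simp: tangent.span_singleton)
    then show ?thesis using bilinear_on_scale(2)[OF bil X X, of r] skew[OF X X] by simp
  qed
qed

text \<open>
  The ratio \<open>c (X, X) / ip (X, X)\<close> does not change when \<open>X\<close> is scaled and is continuous on the compact
  sphere, so it attains its minimum.
\<close>

lemma minimal_ratio_of_forms:
  assumes c: "bilinear_on (lie_algebra K) c" and ip: "inner_product_on (lie_algebra K) ip"
    and nz: "lie_algebra K \<noteq> {0}"
  shows "\<exists>lam. \<exists>X0\<in>lie_algebra K. X0 \<noteq> 0 \<and> c X0 X0 = lam * ip X0 X0 \<and>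
    (\<forall>X\<in>lie_algebra K. lam * ip X X \<le> c X X)"
proof -
  have ipb: "bilinear_on (lie_algebra K) ip"
    by (rule inner_product_on_imp_bilinear_on[OF subspace_lie_algebra ip])
  have pos: "ip X X > 0" if "X \<in> lie_algebra K" "X \<noteq> 0" for X
    using ip that by (simp add: inner_product_on_def)
  define vec where "vec y = (\<Sum>i<n. y i *\<^sub>t basis i)" for y
  have vec_in: "vec y \<in> lie_algebra K" for y unfolding vec_def by (rule basis_combination(1))
  have quad: "b (vec y) (vec y) = (\<Sum>l<n. \<Sum>m<n. y l * y m * b (basis l) (basis m))"
    if "bilinear_on (lie_algebra K) b" for b y
    using bilinear_coord[OF that vec_in vec_in] by (simp add: vec_def basis_combination(2))
  have cont: "continuous_on UNIV (\<lambda>y. b (vec y) (vec y))" if "bilinear_on (lie_algebra K) b" for b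
    unfolding quad[OF that] by (intro continuous_intros) auto
  define S where "S = {y :: nat \<Rightarrow> real. (\<forall>i. \<bar>y i\<bar> \<le> 1) \<and> (\<forall>i\<ge>n. y i = 0) \<and> (\<exists>i<n. \<bar>y i\<bar> = 1)}"
  have S: "compact S" unfolding S_def by (rule compact_max_norm_sphere)
  have S_nz: "vec y \<noteq> 0" if y: "y \<in> S" for y
  proof
    obtain i where i: "i < n" "\<bar>y i\<bar> = 1" using y by (auto simp: S_def)
    assume "vec y = 0"
    then have "vec y c0 i = 0" by simp
    with i show False by (simp add: vec_def basis_combination(2))
  qed
  have scale: "\<exists>y\<in>S. \<exists>r. X = r *\<^sub>t vec y" if X: "X \<in> lie_algebra K" "X \<noteq> 0" for X
  proof -
    have pad: "X c0 i = 0" if "i \<ge> n" for i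
      using X(1) that by (auto simp: lie_algebra_def intro: tangent_space_pad)
    have "\<exists>i<n. X c0 i \<noteq> 0"
    proof (rule ccontr)
      assume "\<not> ?thesis"
      then have "(\<Sum>i<n. X c0 i *\<^sub>t basis i) = 0" by simp
      then show False using lie_algebra_expand[OF X(1)] X(2) by simp
    qed
    then obtain i where i: "i < n" "X c0 i \<noteq> 0" by blast
    define r where "r = Max ((\<lambda>i. \<bar>X c0 i\<bar>) ` {..<n})"
    have le: "\<bar>X c0 k\<bar> \<le> r" if "k < n" for k
      unfolding r_def using that by (intro Max_ge) auto
    then have r: "r > 0" using i by fastforce
    have "r \<in> (\<lambda>i. \<bar>X c0 i\<bar>) ` {..<n}"
      unfolding r_def using i by (intro Max_in) auto
    then obtain k where k: "k < n" "\<bar>X c0 k\<bar> = r" by auto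
    have "(\<lambda>i. X c0 i / r) \<in> S"
      unfolding S_def mem_Collect_eq
    proof (intro conjI allI impI)
      show "\<bar>X c0 i / r\<bar> \<le> 1" for i
        using le[of i] pad[of i] r by (cases "i < n") (auto simp: divide_le_eq_1_pos)
      show "\<exists>i<n. \<bar>X c0 i / r\<bar> = 1" using k r by (intro exI[of _ k]) auto
    qed (simp add: pad)
    moreover have "X = r *\<^sub>t vec (\<lambda>i. X c0 i / r)"
      using r lie_algebra_expand[OF X(1)] unfolding vec_def tangent.scale_sum_right by simp
    ultimately show ?thesis by blast
  qed
  obtain X1 where "X1 \<in> lie_algebra K" "X1 \<noteq> 0"
    using nz tangent.subspace_0[OF subspace_lie_algebra] by blast
  then have "S \<noteq> {}" using scale by blast
  define f where "f y = c (vec y) (vec y) / ip (vec y) (vec y)" for y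
  have "continuous_on S f"
    unfolding f_def
  proof (rule continuous_on_divide)
    show "\<forall>y\<in>S. ip (vec y) (vec y) \<noteq> 0" using pos[OF vec_in S_nz] by force
  qed (use cont[OF c] cont[OF ipb] in \<open>auto intro: continuous_on_subset\<close>)
  then obtain y0 where y0: "y0 \<in> S" "\<And>y. y \<in> S \<Longrightarrow> f y0 \<le> f y"
    using continuous_attains_inf[OF S \<open>S \<noteq> {}\<close>] by blast
  have "f y0 * ip X X \<le> c X X" if X: "X \<in> lie_algebra K" for X
  proof (cases "X = 0")
    case True
    then show ?thesis using bilinear_on_zero[OF ipb X] bilinear_on_zero[OF c X] by simp
  next
    case False
    then obtain y r where y: "y \<in> S" "X = r *\<^sub>t vec y" using scale X by blast
    have "f y0 * ip (vec y) (vec y) \<le> c (vec y) (vec y)"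
      using y0(2)[OF y(1)] pos[OF vec_in S_nz[OF y(1)]] by (simp add: f_def[of y] pos_le_divide_eq)
    then have "r\<^sup>2 * (f y0 * ip (vec y) (vec y)) \<le> r\<^sup>2 * c (vec y) (vec y)"
      by (rule mult_left_mono) simp
    moreover have "b X X = r\<^sup>2 * b (vec y) (vec y)" if "bilinear_on (lie_algebra K) b" for b
      using X by (simp add: y(2) bilinear_on_scale[OF that vec_in] vec_in power2_eq_square)
    ultimately show ?thesis using c ipb by (simp add: mult.left_commute)
  qed
  moreover have "c (vec y0) (vec y0) = f y0 * ip (vec y0) (vec y0)"
    using pos[OF vec_in S_nz[OF y0(1)]] by (simp add: f_def)
  ultimately show ?thesis using vec_in S_nz[OF y0(1)] by blast
qed

lemma Ad_invariant_inner_imp_invariant_form: "Ad_invariant_inner K ip \<Longrightarrow> invariant_form ip"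
  using inner_product_on_imp_bilinear_on[OF subspace_lie_algebra]
  by (auto simp: invariant_form_def Ad_invariant_inner_def)

lemma invariant_form_combination:
  assumes "invariant_form b" "invariant_form c"
  shows "invariant_form (\<lambda>X Y. r * b X Y + s * c X Y)"
  using assms unfolding invariant_form_def bilinear_on_def by (simp add: algebra_simps)

lemma invariant_form_flip: "invariant_form c \<Longrightarrow> invariant_form (\<lambda>X Y. c Y X)"
  unfolding invariant_form_def bilinear_on_def by blast

text \<open>
  Subtracting the minimal ratio times \<open>ip\<close> leaves a positive semidefinite form with a nonzero null
  vector. That vector lies in the radical, which is therefore the whole algebra.
\<close>

lemma symmetric_invariant_form_proportional:
  assumes simple: "\<forall>I. lie_ideal K I \<longrightarrow> I = {0} \<or> I = lie_algebra K"
    and ip: "Ad_invariant_inner K ip" and c: "invariant_form c"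
    and sym: "\<And>X Y. X \<in> lie_algebra K \<Longrightarrow> Y \<in> lie_algebra K \<Longrightarrow> c X Y = c Y X"
  shows "\<exists>r. \<forall>X\<in>lie_algebra K. \<forall>Y\<in>lie_algebra K. c X Y = r * ip X Y"
proof (cases "lie_algebra K = {0}")
  case True
  then show ?thesis
    using bilinear_on_zero[OF invariant_form_bilinear[OF c]]
      bilinear_on_zero[OF invariant_form_bilinear[OF Ad_invariant_inner_imp_invariant_form[OF ip]]]
    by auto
next
  case False
  have ip': "inner_product_on (lie_algebra K) ip" using ip by (simp add: Ad_invariant_inner_def)
  obtain r X0 where X0: "X0 \<in> lie_algebra K" "X0 \<noteq> 0" "c X0 X0 = r * ip X0 X0"
    and min: "\<And>X. X \<in> lie_algebra K \<Longrightarrow> r * ip X X \<le> c X X"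
    using minimal_ratio_of_forms[OF invariant_form_bilinear[OF c] ip' False] by blast
  define q where "q = (\<lambda>X Y. 1 * c X Y + (- r) * ip X Y)"
  have q: "invariant_form q"
    unfolding q_def by (rule invariant_form_combination[OF c Ad_invariant_inner_imp_invariant_form[OF ip]])
  have "q X0 Z = 0" if "Z \<in> lie_algebra K" for Z
  proof (rule positive_semidefinite_kernel[OF invariant_form_bilinear[OF q] subspace_lie_algebra])
    show "q u v = q v u" if "u \<in> lie_algebra K" "v \<in> lie_algebra K" for u v
      using sym[OF that] ip' that by (simp add: q_def inner_product_on_def)
  qed (use X0 min that in \<open>auto simp: q_def\<close>)
  then have "{Y \<in> lie_algebra K. \<forall>Z\<in>lie_algebra K. q Y Z = 0} \<noteq> {0}" using X0 by blast
  then have "{Y \<in> lie_algebra K. \<forall>Z\<in>lie_algebra K. q Y Z = 0} = lie_algebra K"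
    using simple[rule_format, OF radical_is_ideal[OF q]] by blast
  then have "\<forall>X\<in>lie_algebra K. \<forall>Y\<in>lie_algebra K. q X Y = 0" by blast
  then show ?thesis by (intro exI[of _ r]) (simp add: q_def)
qed

lemma invariant_form_proportional:
  assumes simple: "\<forall>I. lie_ideal K I \<longrightarrow> I = {0} \<or> I = lie_algebra K"
    and ip: "Ad_invariant_inner K ip" and c: "invariant_form c"
  shows "\<exists>r. \<forall>X\<in>lie_algebra K. \<forall>Y\<in>lie_algebra K. c X Y = r * ip X Y"
proof -
  have skew: "c X Y - c Y X = 0" if "X \<in> lie_algebra K" "Y \<in> lie_algebra K" for X Y
    using skew_invariant_form_zero[OF simple
        invariant_form_combination[OF c invariant_form_flip[OF c], of 1 "-1"] _ that]
    by simp
  show ?thesis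
    by (rule symmetric_invariant_form_proportional[OF simple ip c]) (use skew in force)
qed

lemma one_dimensional_ideals:
  assumes n: "n = 1" and I: "lie_ideal K I"
  shows "I = {0} \<or> I = lie_algebra K"
proof (cases "I = {0}")
  case False
  have sub: "tangent.subspace I" "I \<subseteq> lie_algebra K" using I by (auto simp: lie_ideal_def)
  then obtain X where X: "X \<in> I" "X \<noteq> 0" using False tangent.subspace_0 by blast
  have one: "Z = Z c0 0 *\<^sub>t basis 0" if "Z \<in> lie_algebra K" for Z
    using lie_algebra_expand[OF that] n by simp
  have "X c0 0 \<noteq> 0" using one[of X] X sub by auto
  have "Y \<in> I" if Y: "Y \<in> lie_algebra K" for Y
  proof -
    have "Y = (Y c0 0 / X c0 0) *\<^sub>t X"
    proof (rule trans[OF one[OF Y]])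
      have "X = X c0 0 *\<^sub>t basis 0" using one X sub by blast
      then have "(Y c0 0 / X c0 0) *\<^sub>t X = (Y c0 0 / X c0 0) *\<^sub>t (X c0 0 *\<^sub>t basis 0)" by simp
      then show "Y c0 0 *\<^sub>t basis 0 = (Y c0 0 / X c0 0) *\<^sub>t X"
        using \<open>X c0 0 \<noteq> 0\<close> by simp
    qed
    then show ?thesis using tangent.subspace_scale[OF sub(1) X(1)] by metis
  qed
  then show ?thesis using sub by blast
qed simp

end

section \<open>Invariant inner products on the complexified Lie algebra\<close>

lemma Jmul_linear: "Jmul (u + v) = Jmul u + Jmul v" "Jmul (r *\<^sub>t v) = r *\<^sub>t Jmul v"
  by (auto simp: Jmul_def tscale_def fun_eq_iff)

lemma plusJ_add: "plusJ K KC \<iota> (X + X') (Y + Y') = plusJ K KC \<iota> X Y + plusJ K KC \<iota> X' Y'"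
  by (simp add: plusJ_def Let_def differential_add Jmul_linear)

lemma plusJ_scale: "plusJ K KC \<iota> (r *\<^sub>t X) (r *\<^sub>t Y) = r *\<^sub>t plusJ K KC \<iota> X Y"
  by (simp add: plusJ_def Let_def differential_scale Jmul_linear tangent.scale_right_distrib)

lemma Ad_scale: "Ad K x (r *\<^sub>t X) = r *\<^sub>t Ad K x X"
  by (simp add: Ad_def differential_scale)

lemma AdC_plusJ:
  assumes "lie_algebra_splits K KC \<iota>" "X \<in> lie_algebra K" "Y \<in> lie_algebra K"
  shows "AdC K KC \<iota> x (plusJ K KC \<iota> X Y) = plusJ K KC \<iota> (Ad K x X) (Ad K x Y)"
proof -
  let ?f = "\<lambda>(X, Y). plusJ K KC \<iota> X Y"
  have "inv_into (lie_algebra K \<times> lie_algebra K) ?f (?f (X, Y)) = (X, Y)"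
    using assms by (intro inv_into_f_f) (auto simp: lie_algebra_splits_def bij_betw_def)
  then show ?thesis by (simp add: AdC_def)
qed

lemma plusJ_in: "lie_algebra_splits K KC \<iota> \<Longrightarrow> X \<in> lie_algebra K \<Longrightarrow> Y \<in> lie_algebra K \<Longrightarrow>
    plusJ K KC \<iota> X Y \<in> lie_algebra KC"
  unfolding lie_algebra_splits_def by (drule bij_betw_imp_surj_on) force

context lie
begin

text \<open>
  The map \<open>X \<mapsto> s X + J t X\<close> intertwines \<open>Ad\<close> with its complex extension. The parameters \<open>(1, 0)\<close> and
  \<open>(0, 1)\<close> give the embeddings of \<open>k\<close> and \<open>J k\<close>, and thereby all three blocks of \<open>B\<close> at once.
\<close>

lemma pullback_invariant_form:
  assumes split: "lie_algebra_splits K KC \<iota>" and B: "AdK_invariant_inner K KC \<iota> B"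
  shows "invariant_form (\<lambda>X Y. B (plusJ K KC \<iota> (s *\<^sub>t X) (t *\<^sub>t X)) (plusJ K KC \<iota> (s' *\<^sub>t Y) (t' *\<^sub>t Y)))"
proof -
  let ?j = "\<lambda>s t X. plusJ K KC \<iota> (s *\<^sub>t X) (t *\<^sub>t X)"
  have sc: "r *\<^sub>t X \<in> lie_algebra K" if "X \<in> lie_algebra K" for r X
    using that subspace_lie_algebra by (auto intro: tangent.subspace_scale)
  have j_in: "?j s t X \<in> lie_algebra KC" if "X \<in> lie_algebra K" for s t X
    by (intro plusJ_in[OF split] sc that)
  have j_add: "?j s t (X + Y) = ?j s t X + ?j s t Y" for s t X Y
    by (simp add: tangent.scale_right_distrib plusJ_add)
  have j_scale: "plusJ K KC \<iota> ((s * r) *\<^sub>t X) ((t * r) *\<^sub>t X) = r *\<^sub>t ?j s t X" for s t r X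
    unfolding plusJ_scale[symmetric] by (simp add: mult.commute)
  have j_Ad: "?j s t (Ad K x X) = AdC K KC \<iota> x (?j s t X)" if "X \<in> lie_algebra K" for s t x X
    by (simp add: AdC_plusJ[OF split sc[OF that] sc[OF that]] Ad_scale)
  have "inner_product_on (lie_algebra KC) B" using B by (simp add: AdK_invariant_inner_def)
  then have bil: "bilinear_on (lie_algebra KC) B"
    by (intro inner_product_on_imp_bilinear_on) (simp_all add: lie_algebra_def subspace_tangent_space)
  have inv: "B (AdC K KC \<iota> x Z) (AdC K KC \<iota> x W) = B Z W"
    if "x \<in> carrier K" "Z \<in> lie_algebra KC" "W \<in> lie_algebra KC" for x Z W
    using B that by (simp add: AdK_invariant_inner_def)
  show ?thesis
    unfolding invariant_form_def bilinear_on_def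
    using j_in by (auto simp: j_add j_scale j_Ad inv bilinear_on_add[OF bil] bilinear_on_scale[OF bil])
qed

end

theorem theorem3p2:
  fixes K :: "'a lie_struct" and KC :: "'b lie_struct" and \<iota> :: "'a \<Rightarrow> 'b"
  assumes "compact_type K"
    and "simple_lie_group K \<or> mdim (mfld K) = 1"
    and "is_complexification K KC \<iota>"
    and "lie_algebra_splits K KC \<iota>"
  shows "(\<exists>ip. Ad_invariant_inner K ip) \<and>
    (\<forall>ip ip'. Ad_invariant_inner K ip \<and> Ad_invariant_inner K ip' \<longrightarrow>
       (\<exists>r>0. \<forall>X\<in>lie_algebra K. \<forall>Y\<in>lie_algebra K. ip' X Y = r * ip X Y)) \<and>
    (\<forall>ip B. Ad_invariant_inner K ip \<and> AdK_invariant_inner K KC \<iota> B \<longrightarrow>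
       (\<exists>a b c :: real. a > 0 \<and> b > 0 \<and> c\<^sup>2 < a * b \<and>
          (\<forall>X1\<in>lie_algebra K. \<forall>Y1\<in>lie_algebra K. \<forall>X2\<in>lie_algebra K. \<forall>Y2\<in>lie_algebra K.
             B (plusJ K KC \<iota> X1 Y1) (plusJ K KC \<iota> X2 Y2) =
               a * ip X1 X2 + b * ip Y1 Y2 + c * (ip X1 Y2 + ip X2 Y1))))"
proof -
  interpret lie K
    by unfold_locales (use assms(1) in \<open>simp add: compact_type_def\<close>)
  have simple: "\<forall>I. lie_ideal K I \<longrightarrow> I = {0} \<or> I = lie_algebra K"
    using assms(2) one_dimensional_ideals by (auto simp: simple_lie_group_def)
  note proportional = invariant_form_proportional[OF simple]
  have V0: "0 \<in> lie_algebra K" by (rule tangent.subspace_0[OF subspace_lie_algebra])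
  have ip_pos: "ip X X > 0" if "Ad_invariant_inner K ip" "X \<in> lie_algebra K" "X \<noteq> 0" for ip X
    using that by (simp add: Ad_invariant_inner_def inner_product_on_def)
  have ip_bil: "bilinear_on (lie_algebra K) ip" if "Ad_invariant_inner K ip" for ip
    by (intro invariant_form_bilinear Ad_invariant_inner_imp_invariant_form that)
  show ?thesis
  proof (intro conjI allI impI; (elim conjE)?)
    show "\<exists>ip. Ad_invariant_inner K ip" using assms(1) by (simp add: compact_type_def)
  next
    fix ip ip' assume ip: "Ad_invariant_inner K ip" and ip': "Ad_invariant_inner K ip'"
    obtain r where r: "\<forall>X\<in>lie_algebra K. \<forall>Y\<in>lie_algebra K. ip' X Y = r * ip X Y"
      using proportional[OF ip Ad_invariant_inner_imp_invariant_form[OF ip']] by blast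
    show "\<exists>r>0. \<forall>X\<in>lie_algebra K. \<forall>Y\<in>lie_algebra K. ip' X Y = r * ip X Y"
    proof (cases "lie_algebra K = {0}")
      case True
      then show ?thesis
        using bilinear_on_zero[OF ip_bil[OF ip] V0] bilinear_on_zero[OF ip_bil[OF ip'] V0]
        by (intro exI[of _ 1]) simp
    next
      case False
      then obtain X where X: "X \<in> lie_algebra K" "X \<noteq> 0" using V0 by blast
      have "r * ip X X > 0" using ip_pos[OF ip' X] r X by simp
      then have "r > 0" using ip_pos[OF ip X] by (simp add: zero_less_mult_iff)
      then show ?thesis using r by blast
    qed
  next
    fix ip B assume ip: "Ad_invariant_inner K ip" and B: "AdK_invariant_inner K KC \<iota> B"
    note split = assms(4)
    let ?j = "plusJ K KC \<iota>"
    have IB: "inner_product_on (lie_algebra KC) B" using B by (simp add: AdK_invariant_inner_def)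
    then have bil: "bilinear_on (lie_algebra KC) B"
      by (intro inner_product_on_imp_bilinear_on) (simp_all add: lie_algebra_def subspace_tangent_space)
    have symB: "B Z W = B W Z" if "Z \<in> lie_algebra KC" "W \<in> lie_algebra KC" for Z W
      using IB that by (simp add: inner_product_on_def)
    have posB: "B Z Z > 0" if "Z \<in> lie_algebra KC" "Z \<noteq> 0" for Z
      using IB that by (simp add: inner_product_on_def)
    note j_in = plusJ_in[OF split]
    have j00: "?j 0 0 = 0" using plusJ_scale[of K KC \<iota> 0 0 0] by simp
    have j_nz: "?j X Y \<noteq> 0" if "X \<in> lie_algebra K" "Y \<in> lie_algebra K" "(X, Y) \<noteq> (0, 0)" for X Y
    proof
      assume "?j X Y = 0"
      then have "(\<lambda>(X, Y). ?j X Y) (X, Y) = (\<lambda>(X, Y). ?j X Y) (0, 0)" by (simp add: j00)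
      then have "(X, Y) = (0, 0)"
        using split that V0 unfolding lie_algebra_splits_def bij_betw_def by (blast dest: inj_onD)
      with that show False by simp
    qed
    obtain a where a: "\<And>X Y. X \<in> lie_algebra K \<Longrightarrow> Y \<in> lie_algebra K \<Longrightarrow> B (?j X 0) (?j Y 0) = a * ip X Y"
      using proportional[OF ip pullback_invariant_form[OF split B, of 1 0 1 0]] by auto
    obtain b where b: "\<And>X Y. X \<in> lie_algebra K \<Longrightarrow> Y \<in> lie_algebra K \<Longrightarrow> B (?j 0 X) (?j 0 Y) = b * ip X Y"
      using proportional[OF ip pullback_invariant_form[OF split B, of 0 1 0 1]] by auto
    obtain c where c: "\<And>X Y. X \<in> lie_algebra K \<Longrightarrow> Y \<in> lie_algebra K \<Longrightarrow> B (?j X 0) (?j 0 Y) = c * ip X Y"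
      using proportional[OF ip pullback_invariant_form[OF split B, of 1 0 0 1]] by auto
    have form: "B (?j X1 Y1) (?j X2 Y2) = a * ip X1 X2 + b * ip Y1 Y2 + c * (ip X1 Y2 + ip X2 Y1)"
      if V: "X1 \<in> lie_algebra K" "Y1 \<in> lie_algebra K" "X2 \<in> lie_algebra K" "Y2 \<in> lie_algebra K" for X1 Y1 X2 Y2
    proof -
      have dec: "?j X Y = ?j X 0 + ?j 0 Y" for X Y using plusJ_add[of K KC \<iota> X 0 0 Y] by simp
      have "B (?j X1 Y1) (?j X2 Y2) = B (?j X1 0) (?j X2 0) + B (?j X1 0) (?j 0 Y2)
          + (B (?j 0 Y1) (?j X2 0) + B (?j 0 Y1) (?j 0 Y2))"
        unfolding dec[of X1 Y1] bilinear_on_add(1)[OF bil j_in[OF V(1) V0] j_in[OF V0 V(2)] j_in[OF V(3,4)]]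
        unfolding dec[of X2 Y2] bilinear_on_add(2)[OF bil j_in[OF V(3) V0] j_in[OF V0 V(4)] j_in[OF V(1) V0]]
          bilinear_on_add(2)[OF bil j_in[OF V(3) V0] j_in[OF V0 V(4)] j_in[OF V0 V(2)]] ..
      also have "B (?j 0 Y1) (?j X2 0) = c * ip X2 Y1"
        using symB[OF j_in[OF V0 V(2)] j_in[OF V(3) V0]] c[OF V(3,2)] by simp
      finally show ?thesis unfolding a[OF V(1,3)] b[OF V(2,4)] c[OF V(1,4)] by (simp add: algebra_simps)
    qed
    show "\<exists>a b c :: real. a > 0 \<and> b > 0 \<and> c\<^sup>2 < a * b \<and>
          (\<forall>X1\<in>lie_algebra K. \<forall>Y1\<in>lie_algebra K. \<forall>X2\<in>lie_algebra K. \<forall>Y2\<in>lie_algebra K.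
             B (?j X1 Y1) (?j X2 Y2) = a * ip X1 X2 + b * ip Y1 Y2 + c * (ip X1 Y2 + ip X2 Y1))"
    proof (cases "lie_algebra K = {0}")
      case True
      have "B 0 0 = 0" "ip 0 0 = 0"
        using bilinear_on_zero[OF bil j_in[OF V0 V0]] bilinear_on_zero[OF ip_bil[OF ip] V0] j00 by auto
      with True show ?thesis
        by (intro exI[of _ 1] exI[of _ 0]) (simp add: j00)
    next
      case False
      then obtain X where X: "X \<in> lie_algebra K" "X \<noteq> 0" using V0 by blast
      note pos = ip_pos[OF ip X]
      have "a * ip X X > 0"
        using posB[OF j_in[OF X(1) V0] j_nz[OF X(1) V0]] a[OF X(1) X(1)] X(2) by simp
      then have a0: "a > 0" using pos by (simp add: zero_less_mult_iff)
      have "b * ip X X > 0"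
        using posB[OF j_in[OF V0 X(1)] j_nz[OF V0 X(1)]] b[OF X(1) X(1)] X(2) by simp
      then have b0: "b > 0" using pos by (simp add: zero_less_mult_iff)
      \<comment> \<open>\<open>- c X + a J X\<close> is the multiple by \<open>a\<close> of the component of \<open>J X\<close> orthogonal to \<open>X\<close>, so the
        square of its length has the sign of \<open>a b - c\<^sup>2\<close>.\<close>
      have V: "(- c) *\<^sub>t X \<in> lie_algebra K" "a *\<^sub>t X \<in> lie_algebra K"
        by (rule tangent.subspace_scale[OF subspace_lie_algebra X(1)])+
      have sc: "ip (s *\<^sub>t X) (t *\<^sub>t X) = s * t * ip X X" for s t
        using bilinear_on_scale(1)[OF ip_bil[OF ip] X(1) tangent.subspace_scale[OF subspace_lie_algebra X(1)]]
          bilinear_on_scale(2)[OF ip_bil[OF ip] X(1) X(1)] by simp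
      have "a *\<^sub>t X \<noteq> 0" using a0 X(2) by simp
      then have "0 < B (?j ((- c) *\<^sub>t X) (a *\<^sub>t X)) (?j ((- c) *\<^sub>t X) (a *\<^sub>t X))"
        by (intro posB j_in j_nz V) auto
      also have "\<dots> = a * (a * b - c\<^sup>2) * ip X X"
        unfolding form[OF V V] sc by (simp add: power2_eq_square algebra_simps)
      finally have "c\<^sup>2 < a * b" using a0 pos by (simp add: zero_less_mult_iff)
      then show ?thesis using a0 b0 form by blast
    qed
  qed
qed

end
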